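(* Let $0<p<1/2$, let $f\in H_p(G_m)$, and let $\{q_k:k\ge 0\}$ be a non-decreasing sequence of nonnegative numbers with $q_0>0$, $Q_n\to\infty$ and $q_{n-1}/Q_n\to 0$. Then there is a constant $c_p$ depending only on $p$ such that $$\sum_{k=1}^{\infty}\frac{\|t_kf\|_p^p}{k^{2-2p}}\le c_p\|f\|_{H_p}^p .$$
   Context: Let $m=(m_0,m_1,\dots)$ be a bounded sequence of integers $m_k\ge 2$ ($\sup_k m_k<\infty$). $G_m$ is the complete direct product of the cyclic groups $Z_{m_k}=\{0,\dots,m_k-1\}$ (discrete), with Haar probability measure $\mu$ (product of uniform measures). Elements are $x=(x_0,x_1,\dots)$, $x_j\in Z_{m_j}$. $M_0=1$, $M_{k+1}=m_kM_k$; every $n\in\mathbb N$ is written uniquely as $n=\sum_j n_jM_j$ with $n_j\in Z_{m_j}$. $I_n(x)=\{y: y_0=x_0,\dots,y_{n-1}=x_{n-1}\}$, $I_n=I_n(0)$, and $\mathcal F_n$ is the $\sigma$-algebra generated by the sets $I_n(x)$. Rademacher functions $r_k(x)=\exp(2\pi i x_k/m_k)$, Vilenkin system $\psi_n=\prod_k r_k^{n_k}$. For a martingale $f=(f^{(n)})$ with respect to $(\mathcal F_n)$, $\hat f(i)=\lim_k\int_{G_m} f^{(k)}\overline{\psi_i}\,d\mu$, $S_nf=\sum_{k=0}^{n-1}\hat f(k)\psi_k$, and $D_n=\sum_{k=0}^{n-1}\psi_k$. The Hardy space $H_p$ ($0<p<\infty$) consists of martingales with $\|f\|_{H_p}:=\|\sup_n|f^{(n)}|\|_p<\infty$.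 For a sequence $q_k\ge0$ with $q_0>0$, $Q_n:=\sum_{k=0}^{n-1}q_k$, the Nörlund mean is $t_nf=\frac1{Q_n}\sum_{k=1}^n q_{n-k}S_kf$. *)

theory Defs
  imports "HOL-Probability.Probability"
begin

text \<open>Vilenkin group G_m: sequences x with x j < m j, with Haar probability measure
  = product of the uniform measures on Z_{m_j} = {0,...,m_j - 1}.\<close>

definition vil_mu :: "(nat \<Rightarrow> nat) \<Rightarrow> (nat \<Rightarrow> nat) measure" where
  "vil_mu m = PiM UNIV (\<lambda>j. uniform_count_measure {..<m j})"

definition vil_M :: "(nat \<Rightarrow> nat) \<Rightarrow> nat \<Rightarrow> nat" where
  "vil_M m k = (\<Prod>j<k. m j)"

definition vil_digit :: "(nat \<Rightarrow> nat) \<Rightarrow> nat \<Rightarrow> nat \<Rightarrow> nat" where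
  "vil_digit m n k = (n div vil_M m k) mod m k"

definition vil_I :: "(nat \<Rightarrow> nat) \<Rightarrow> nat \<Rightarrow> (nat \<Rightarrow> nat) \<Rightarrow> (nat \<Rightarrow> nat) set" where
  "vil_I m n x = {y \<in> space (vil_mu m). \<forall>j<n. y j = x j}"

definition rademacher :: "(nat \<Rightarrow> nat) \<Rightarrow> nat \<Rightarrow> (nat \<Rightarrow> nat) \<Rightarrow> complex" where
  "rademacher m k x = exp (2 * pi * \<i> * of_nat (x k) / of_nat (m k))"

text \<open>psi_n = prod_k r_k^{n_k}; digits n_k vanish for k >= n since M_k >= 2^k > k.\<close>
definition vilenkin :: "(nat \<Rightarrow> nat) \<Rightarrow> nat \<Rightarrow> (nat \<Rightarrow> nat) \<Rightarrow> complex" where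
  "vilenkin m n x = (\<Prod>k<n. rademacher m k x ^ vil_digit m n k)"

text \<open>Martingale with respect to the filtration (F_n): f n is F_n-measurable
  (F_n is generated by the finitely many atoms I_n(x), so this means f n is constant on
  each I_n(x)) and f n = E(f (n+1) | F_n), i.e. the integrals over every atom I_n(x)
  agree.\<close>
definition vil_martingale :: "(nat \<Rightarrow> nat) \<Rightarrow> (nat \<Rightarrow> (nat \<Rightarrow> nat) \<Rightarrow> complex) \<Rightarrow> bool" where
  "vil_martingale m f \<longleftrightarrow>
     (\<forall>n. \<forall>x \<in> space (vil_mu m). \<forall>y \<in> vil_I m n x. f n y = f n x) \<and>
     (\<forall>n. \<forall>x \<in> space (vil_mu m).
        (LINT y:vil_I m n x|vil_mu m. f (Suc n) y) = (LINT y:vil_I m n x|vil_mu m. f n y))"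

definition Hp_norm_pow :: "(nat \<Rightarrow> nat) \<Rightarrow> real \<Rightarrow> (nat \<Rightarrow> (nat \<Rightarrow> nat) \<Rightarrow> complex) \<Rightarrow> ennreal" where
  "Hp_norm_pow m p f = (\<integral>\<^sup>+ x. (SUP n. ennreal (cmod (f n x) powr p)) \<partial>vil_mu m)"

definition in_Hp :: "(nat \<Rightarrow> nat) \<Rightarrow> real \<Rightarrow> (nat \<Rightarrow> (nat \<Rightarrow> nat) \<Rightarrow> complex) \<Rightarrow> bool" where
  "in_Hp m p f \<longleftrightarrow> vil_martingale m f \<and> Hp_norm_pow m p f < \<infinity>"

definition fourier_coeff :: "(nat \<Rightarrow> nat) \<Rightarrow> (nat \<Rightarrow> (nat \<Rightarrow> nat) \<Rightarrow> complex) \<Rightarrow> nat \<Rightarrow> complex" where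
  "fourier_coeff m f i = lim (\<lambda>k. LINT x|vil_mu m. f k x * cnj (vilenkin m i x))"

definition partial_sum :: "(nat \<Rightarrow> nat) \<Rightarrow> (nat \<Rightarrow> (nat \<Rightarrow> nat) \<Rightarrow> complex) \<Rightarrow> nat \<Rightarrow> (nat \<Rightarrow> nat) \<Rightarrow> complex" where
  "partial_sum m f n x = (\<Sum>k<n. fourier_coeff m f k * vilenkin m k x)"

definition norlund_Q :: "(nat \<Rightarrow> real) \<Rightarrow> nat \<Rightarrow> real" where
  "norlund_Q q n = (\<Sum>k<n. q k)"

definition norlund_mean :: "(nat \<Rightarrow> nat) \<Rightarrow> (nat \<Rightarrow> real) \<Rightarrow> (nat \<Rightarrow> (nat \<Rightarrow> nat) \<Rightarrow> complex) \<Rightarrow> nat \<Rightarrow> (nat \<Rightarrow> nat) \<Rightarrow> complex" where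
  "norlund_mean m q f n x =
     (1 / of_real (norlund_Q q n)) * (\<Sum>k=1..n. of_real (q (n - k)) * partial_sum m f k x)"

definition Lp_norm_pow :: "(nat \<Rightarrow> nat) \<Rightarrow> real \<Rightarrow> ((nat \<Rightarrow> nat) \<Rightarrow> complex) \<Rightarrow> ennreal" where
  "Lp_norm_pow m p g = (\<integral>\<^sup>+ x. ennreal (cmod (g x) powr p) \<partial>vil_mu m)"

end

theory Submission
  imports Defs
begin

text \<open>The Norlund means are averages of the partial sums with weights \<open>q (n - k)\<close> that decrease in
  \<open>k\<close>; by Abel summation they are therefore dominated pointwise by the Fejer means, and only
  kernel estimates for \<open>D_1 + ... + D_n\<close> are needed. If \<open>x\<close> and \<open>t\<close> differ in two digits, the larger
  one at position \<open>l\<close>, this sum is at most \<open>(M (l + 1))^2\<close>, uniformly in \<open>n\<close>. Hence for an atom \<open>a\<close>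
  (of mean zero unless \<open>L = 0\<close>) supported on a cell of level \<open>L\<close> with values bounded by \<open>\<beta>\<close>,
  the mean \<open>t_n a\<close> vanishes for \<open>n < M L\<close>, and \<open>\<parallel>t_n a\<parallel>_p^p\<close> is at most a constant times
  \<open>\<beta>^p (M L)^(-2p)\<close>: on the points that differ from the
  cell in at least two digits the kernel bound applies, and the few remaining points are handled
  by the \<open>L^2\<close> contractivity. Summing against \<open>n^(2p-2)\<close> over \<open>n \<ge> M L\<close> gives \<open>\<beta>^p\<close> times the measure
  of the cell. A martingale is split into such atoms by predictable stopping times at the dyadic
  levels \<open>2^k\<close>, and since \<open>p < 1\<close> the \<open>p\<close>-th powers add up. A partial sum of the series only
  involves finitely many levels, so everything takes place on the cells of a fixed level \<open>N\<close>,
  encoded by the numbers \<open>c < M N\<close> through their mixed radix digits.\<close>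

section \<open>Mixed radix digits, characters and kernels\<close>

locale vilenkin_group =
  fixes m :: "nat \<Rightarrow> nat" and B :: nat
  assumes m_ge2: "\<And>k. m k \<ge> 2"
    and m_le: "\<And>k. m k \<le> B"
begin

abbreviation "M \<equiv> vil_M m"
abbreviation "dg \<equiv> vil_digit m"

lemma m_pos: "m k > 0"
  using m_ge2[of k] by simp

lemma M_0 [simp]: "M 0 = 1"
  by (simp add: vil_M_def)

lemma M_Suc: "M (Suc k) = m k * M k"
  by (simp add: vil_M_def)

lemma M_pos [simp]: "M k > 0"
  using m_pos by (simp add: vil_M_def prod_pos)

lemma M_neq_0 [simp]: "M k \<noteq> 0"
  using M_pos[of k] by simp

lemma power2_le_M: "2 ^ k \<le> M k"
proof (induction k)
  case (Suc k)
  then show ?case using mult_le_mono[OF m_ge2[of k] Suc] by (simp add: M_Suc)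
qed simp

lemma less_M: "k < M k"
  using power2_le_M[of k] less_exp[of k] by linarith

lemma M_dvd: "j \<le> k \<Longrightarrow> M j dvd M k"
  by (induction k rule: dec_induct) (auto simp: M_Suc)

lemma M_mono: "j \<le> k \<Longrightarrow> M j \<le> M k"
  by (rule dvd_imp_le[OF M_dvd]) auto

lemma dg_less [simp]: "dg i j < m j"
  using m_pos by (simp add: vil_digit_def)

lemma dg_eq_0: "i < M k \<Longrightarrow> k \<le> j \<Longrightarrow> dg i j = 0"
  using M_mono[of k j] by (simp add: vil_digit_def)

lemma mod_M_Suc: "c mod M (Suc n) = dg c n * M n + c mod M n"
  using mod_mult2_eq[of c "M n" "m n"] by (simp add: M_Suc vil_digit_def mult.commute)

lemma dg_mod: "j < n \<Longrightarrow> dg (c mod M n) j = dg c j"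
proof -
  assume "j < n"
  then have d: "M (Suc j) dvd M n" by (intro M_dvd) simp
  have "dg (c mod M n) j = (c mod M n mod M (Suc j)) div M j"
    unfolding mod_M_Suc[of "c mod M n"] by simp
  also have "\<dots> = (c mod M (Suc j)) div M j"
    using d by (simp add: mod_mod_cancel)
  also have "\<dots> = dg c j" unfolding mod_M_Suc by simp
  finally show ?thesis .
qed

lemma mod_eq_iff_dg: "x mod M n = t mod M n \<longleftrightarrow> (\<forall>j<n. dg x j = dg t j)"
proof
  assume "x mod M n = t mod M n"
  then show "\<forall>j<n. dg x j = dg t j" using dg_mod by metis
next
  show "\<forall>j<n. dg x j = dg t j \<Longrightarrow> x mod M n = t mod M n"
    by (induction n) (auto simp: mod_M_Suc)
qed

text \<open>No carry occurs: the digits of \<open>v * M k\<close> vanish below \<open>k\<close>,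
  those of \<open>b\<close> from \<open>k\<close> on.\<close>

lemma dg_add_block:
  assumes "b < M k"
  shows "dg (v * M k + b) j = dg (v * M k) j + dg b j"
proof (cases "j < k")
  case True
  have "dg (v * M k + b) j = dg b j"
    using dg_mod[OF True, of "v * M k + b"] dg_mod[OF True, of b] by simp
  moreover have "dg (v * M k) j = 0"
    using dg_mod[OF True, of "v * M k"] by (simp add: vil_digit_def)
  ultimately show ?thesis by simp
next
  case False
  then obtain r where r: "M j = M k * r" using M_dvd[of k j] by (auto elim: dvdE)
  have "(v * M k + b) div M j = (v * M k) div M j"
    using assms by (simp add: r div_mult2_eq)
  then show ?thesis using dg_eq_0[OF assms, of j] False by (simp add: vil_digit_def)
qed

lemma dg_mult_M:
  assumes "v < m k"
  shows "dg (v * M k) j = (if j = k then v else 0)"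
proof -
  consider "j < k" | "j = k" | "k < j" by linarith
  then show ?thesis
  proof cases
    case 1
    then show ?thesis using dg_mod[of j k "v * M k"] by (simp add: vil_digit_def)
  next
    case 2
    then show ?thesis using assms by (simp add: vil_digit_def)
  next
    case 3
    have "v * M k < M (Suc k)" using assms by (simp add: M_Suc)
    then show ?thesis using 3 dg_eq_0[of "v * M k" "Suc k" j] by simp
  qed
qed

lemma sum_lessThan_blocks:
  fixes g :: "nat \<Rightarrow> 'b::comm_monoid_add"
  shows "(\<Sum>i<r * P. g i) = (\<Sum>v<r. \<Sum>b<P. g (v * P + b))"
proof -
  have "(\<Sum>i<r * P. g i) = (\<Sum>v<r. sum g {v * P..<v * P + P})"
    by (simp add: sum.nat_group)
  also have "\<dots> = (\<Sum>v<r. \<Sum>b<P. g (v * P + b))"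
  proof (rule sum.cong[OF refl])
    fix v
    show "sum g {v * P..<v * P + P} = (\<Sum>b<P. g (v * P + b))"
      using sum.shift_bounds_nat_ivl[of g 0 "v * P" P] by (simp add: atLeast0LessThan add.commute)
  qed
  finally show ?thesis .
qed

lemma sum_cell:
  fixes g :: "nat \<Rightarrow> 'b::comm_monoid_add"
  assumes "u < P"
  shows "(\<Sum>c | c < r * P \<and> c mod P = u. g c) = (\<Sum>v<r. g (v * P + u))"
proof -
  have "(\<Sum>c | c < r * P \<and> c mod P = u. g c) = (\<Sum>c<r * P. if c mod P = u then g c else 0)"
    by (subst sum.inter_filter[symmetric]) auto
  also have "\<dots> = (\<Sum>v<r. \<Sum>b<P. if b = u then g (v * P + b) else 0)"
    by (subst sum_lessThan_blocks) (intro sum.cong refl, auto)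
  also have "\<dots> = (\<Sum>v<r. g (v * P + u))"
  proof (intro sum.cong refl)
    fix v
    have "(\<Sum>b<P. if b = u then g (v * P + b) else 0) = (\<Sum>b<P. if b = u then g (v * P + u) else 0)"
      by (intro sum.cong) auto
    then show "(\<Sum>b<P. if b = u then g (v * P + b) else 0) = g (v * P + u)"
      using assms by simp
  qed
  finally show ?thesis .
qed

text \<open>The Vilenkin function of index \<open>i\<close> on the cell of level \<open>N\<close>
  with the digits of \<open>c\<close>. Encoding the cell by a number makes the formula symmetric in
  \<open>i\<close> and \<open>c\<close>.\<close>

definition chi :: "nat \<Rightarrow> nat \<Rightarrow> nat \<Rightarrow> complex" where
  "chi N i c = (\<Prod>k<N. cis (2 * pi * real (dg i k) * real (dg c k) / real (m k)))"

lemma chi_commute: "chi N i c = chi N c i"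
  by (simp add: chi_def mult_ac)

lemma norm_chi [simp]: "norm (chi N i c) = 1"
  by (simp add: chi_def prod_norm[symmetric])

lemma chi_add_block:
  assumes "b < M k"
  shows "chi N (v * M k + b) c = chi N (v * M k) c * chi N b c"
  unfolding chi_def prod.distrib[symmetric] cis_mult dg_add_block[OF assms]
  by (simp add: distrib_left distrib_right add_divide_distrib)

lemma chi_mult_M:
  assumes "v < m k" "k < N"
  shows "chi N (v * M k) c = cis (2 * pi * real (dg c k) / real (m k)) ^ v"
proof -
  have "chi N (v * M k) c
      = (\<Prod>j<N. if j = k then cis (2 * pi * real v * real (dg c k) / real (m k)) else 1)"
    unfolding chi_def by (intro prod.cong refl) (auto simp: dg_mult_M[OF assms(1)])
  also have "\<dots> = cis (2 * pi * real v * real (dg c k) / real (m k))"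
    using assms by (subst prod.delta) auto
  also have "\<dots> = cis (2 * pi * real (dg c k) / real (m k)) ^ v"
    unfolding Complex.DeMoivre by (simp add: mult_ac)
  finally show ?thesis .
qed

lemma chi_mod:
  assumes "i < M L" "L \<le> N" "c mod M L = u mod M L"
  shows "chi N i c = chi N i u"
  unfolding chi_def
proof (intro prod.cong refl)
  fix k
  show "cis (2 * pi * real (dg i k) * real (dg c k) / real (m k)) =
        cis (2 * pi * real (dg i k) * real (dg u k) / real (m k))"
    using assms mod_eq_iff_dg[of c L u] dg_eq_0[OF assms(1), of k]
    by (cases "k < L") auto
qed

text \<open>In the group this is the character of index \<open>i\<close> at \<open>x - t\<close>;
  keeping the pair avoids a digitwise subtraction. Accordingly \<open>dirichlet\<close> is the
  Dirichlet kernel at \<open>x - t\<close> and \<open>dirichlet_sum\<close> an unnormalized Fejer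
  kernel.\<close>

definition pair_char :: "nat \<Rightarrow> nat \<Rightarrow> nat \<Rightarrow> nat \<Rightarrow> complex" where
  "pair_char N x t i = chi N i x * cnj (chi N i t)"

definition dirichlet :: "nat \<Rightarrow> nat \<Rightarrow> nat \<Rightarrow> nat \<Rightarrow> complex" where
  "dirichlet N x t j = (\<Sum>i<j. pair_char N x t i)"

definition dirichlet_sum :: "nat \<Rightarrow> nat \<Rightarrow> nat \<Rightarrow> nat \<Rightarrow> complex" where
  "dirichlet_sum N x t n = (\<Sum>j<n. dirichlet N x t j)"

lemma norm_pair_char [simp]: "norm (pair_char N x t i) = 1"
  by (simp add: pair_char_def norm_mult)

lemma pair_char_add_block: "b < M k \<Longrightarrow> pair_char N x t (v * M k + b)
    = pair_char N x t (v * M k) * pair_char N x t b"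
  by (simp add: pair_char_def chi_add_block mult_ac)

text \<open>A geometric sum over the powers of an \<open>m k\<close>-th root of unity other than
  1.\<close>

lemma sum_pair_char_mult_M:
  assumes "k < N" "dg x k \<noteq> dg t k"
  shows "(\<Sum>v<m k. pair_char N x t (v * M k)) = 0"
proof -
  define z where "z = cis (2 * pi * (real (dg x k) - real (dg t k)) / real (m k))"
  have e: "pair_char N x t (v * M k) = z ^ v" if "v < m k" for v
    using that assms
    by (simp add: pair_char_def chi_mult_M z_def cis_cnj power_mult_distrib[symmetric] cis_mult
        diff_divide_distrib algebra_simps)
  have "z ^ m k = cis (2 * pi * (real_of_int (int (dg x k) - int (dg t k))))"
    unfolding z_def Complex.DeMoivre using m_pos[of k] by simp
  also have "\<dots> = 1" by (rule cis_multiple_2pi) simp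
  finally have z1: "z ^ m k = 1" .
  \<comment> \<open>If \<open>z = 1\<close>, the difference of the two digits is a multiple of
    \<open>m k\<close>; being smaller than \<open>m k\<close> in absolute value, it is 0.\<close>
  have "z \<noteq> 1"
  proof
    assume "z = 1"
    then have "cos (2 * pi * (real (dg x k) - real (dg t k)) / real (m k)) = 1"
      by (simp add: z_def complex_eq_iff)
    then obtain n :: int where n: "2 * pi * (real (dg x k) - real (dg t k)) / real (m k)
        = of_int n * 2 * pi"
      unfolding cos_one_2pi_int by blast
    then have "real (dg x k) - real (dg t k) = of_int n * real (m k)"
    proof -
      have "2 * pi * (real (dg x k) - real (dg t k)) = 2 * pi * (of_int n * real (m k))"
        using n m_pos[of k] by (simp add: field_simps)
      then show ?thesis by (subst (asm) mult_left_cancel) auto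
    qed
    then have eq: "int (dg x k) - int (dg t k) = n * int (m k)"
      by (metis (mono_tags, opaque_lifting) of_int_diff of_int_eq_iff of_int_mult of_int_of_nat_eq)
    have "\<bar>int (dg x k) - int (dg t k)\<bar> < int (m k)"
      using dg_less[of x k] dg_less[of t k] by linarith
    with eq have "\<bar>n\<bar> * int (m k) < 1 * int (m k)" by (simp add: abs_mult)
    then have "n = 0" by (simp only: mult_less_cancel_right) simp
    with eq assms show False by simp
  qed
  then show ?thesis using z1 by (simp add: e geometric_sum)
qed

lemma dirichlet_add_block: "b \<le> M k \<Longrightarrow> dirichlet N x t (v * M k + b)
    = dirichlet N x t (v * M k) + pair_char N x t (v * M k) * dirichlet N x t b"
proof (induction b)
  case (Suc b)
  then have "dirichlet N x t (v * M k + Suc b)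
      = dirichlet N x t (v * M k) + pair_char N x t (v * M k) * dirichlet N x t b
      + pair_char N x t (v * M k + b)"
    by (simp add: dirichlet_def)
  also have "pair_char N x t (v * M k + b) = pair_char N x t (v * M k) * pair_char N x t b"
    using Suc.prems by (intro pair_char_add_block) simp
  finally show ?case by (simp add: dirichlet_def distrib_left)
qed (simp add: dirichlet_def)

lemma dirichlet_M_Suc: "dirichlet N x t (M (Suc k))
    = (\<Sum>v<m k. pair_char N x t (v * M k)) * dirichlet N x t (M k)"
  by (simp add: dirichlet_def M_Suc sum_lessThan_blocks pair_char_add_block sum_product)

text \<open>By \<open>dirichlet_M_Suc\<close> the kernel of order \<open>M n\<close> is a product of
  geometric sums, one per digit, and the factor of digit \<open>k\<close> vanishes.\<close>

lemma dirichlet_M_eq_0: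
  assumes "k < n" "n \<le> N" "dg x k \<noteq> dg t k"
  shows "dirichlet N x t (M n) = 0"
proof -
  have "Suc k \<le> n" using assms by simp
  then show ?thesis
  proof (induction n rule: dec_induct)
    case base
    then show ?case using assms by (simp add: dirichlet_M_Suc sum_pair_char_mult_M)
  next
    case (step n)
    then show ?case by (simp add: dirichlet_M_Suc)
  qed
qed

lemma dirichlet_mult_M_eq_0: "dirichlet N x t (M n) = 0 \<Longrightarrow> dirichlet N x t (v * M n) = 0"
proof (induction v)
  case (Suc v)
  then show ?case using dirichlet_add_block[of "M n" n N x t v] by (simp add: add.commute)
qed (simp add: dirichlet_def)

text \<open>The kernel of order \<open>v * M k\<close> vanishes, so each further kernel in the block
  is a unimodular multiple of a kernel of order at most \<open>M k\<close>.\<close>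

lemma dirichlet_sum_add_block:
  assumes "dirichlet N x t (M k) = 0" "b \<le> M k"
  shows "dirichlet_sum N x t (v * M k + b)
      = dirichlet_sum N x t (v * M k) + pair_char N x t (v * M k) * dirichlet_sum N x t b"
  using assms(2)
proof (induction b)
  case (Suc b)
  then have "dirichlet_sum N x t (v * M k + Suc b)
      = dirichlet_sum N x t (v * M k) + pair_char N x t (v * M k) * dirichlet_sum N x t b
      + dirichlet N x t (v * M k + b)"
    by (simp add: dirichlet_sum_def)
  also have "dirichlet N x t (v * M k + b) = pair_char N x t (v * M k) * dirichlet N x t b"
    using Suc.prems dirichlet_add_block[of b k N x t v] dirichlet_mult_M_eq_0[OF assms(1)] by simp
  finally show ?case by (simp add: dirichlet_sum_def distrib_left)
qed (simp add: dirichlet_sum_def)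

lemma dirichlet_sum_M_Suc:
  assumes "dirichlet N x t (M k) = 0"
  shows "dirichlet_sum N x t (M (Suc k))
      = (\<Sum>v<m k. pair_char N x t (v * M k)) * dirichlet_sum N x t (M k)"
  by (simp add: dirichlet_sum_def M_Suc sum_lessThan_blocks dirichlet_add_block dirichlet_mult_M_eq_0[OF assms] sum_product)

text \<open>Two differing digits make a whole block of Dirichlet kernels cancel, so only the last,
  incomplete block of length below \<open>M (Suc l)\<close> contributes.\<close>
lemma norm_dirichlet_sum_le:
  assumes "k < l" "l < N" "dg x k \<noteq> dg t k" "dg x l \<noteq> dg t l"
  shows "norm (dirichlet_sum N x t n) \<le> (real (M (Suc l)))\<^sup>2"
proof -
  let ?P = "M (Suc l)"
  have D0: "dirichlet N x t (M l) = 0" and D1: "dirichlet N x t ?P = 0"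
    using assms by (auto intro: dirichlet_M_eq_0)
  \<comment> \<open>The differing digit \<open>k\<close> gives \<open>D0\<close>, which lets the sum
    over a block of length \<open>?P\<close> factor; the digit \<open>l\<close> makes the factor
    vanish.\<close>
  have G0: "dirichlet_sum N x t ?P = 0"
    by (simp add: dirichlet_sum_M_Suc[OF D0] sum_pair_char_mult_M assms)
  have Gv: "dirichlet_sum N x t (v * ?P) = 0" for v
  proof (induction v)
    case (Suc v)
    then show ?case using dirichlet_sum_add_block[OF D1, of ?P v] G0 by (simp add: add.commute)
  qed (simp add: dirichlet_sum_def)
  define b where "b = n mod ?P"
  have b: "b < ?P" by (simp add: b_def)
  have nD: "norm (dirichlet N x t j) \<le> real j" for j
    unfolding dirichlet_def by (rule order_trans[OF norm_sum]) simp
  have nb: "n div ?P * ?P + b = n" unfolding b_def by (rule div_mult_mod_eq)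
  have "dirichlet_sum N x t n = pair_char N x t (n div ?P * ?P) * dirichlet_sum N x t b"
    using dirichlet_sum_add_block[OF D1, of b "n div ?P"] b unfolding Gv nb by simp
  then have "norm (dirichlet_sum N x t n) = norm (dirichlet_sum N x t b)" by (simp add: norm_mult)
  also have "\<dots> \<le> (\<Sum>j<b. real ?P)"
    unfolding dirichlet_sum_def using b
    by (intro order_trans[OF norm_sum] sum_mono order_trans[OF nD]) auto
  also have "\<dots> \<le> (real ?P)\<^sup>2"
    using b by (simp add: power2_eq_square mult_right_mono)
  finally show ?thesis .
qed

lemma dirichlet_M_orth:
  assumes "x < M N" "t < M N"
  shows "dirichlet N x t (M N) = (if x = t then of_nat (M N) else 0)"
proof (cases "x = t")
  case True
  have "pair_char N x x i = 1" for i
    by (simp add: pair_char_def complex_norm_square[symmetric])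
  then show ?thesis using True by (simp add: dirichlet_def)
next
  case False
  then have "x mod M N \<noteq> t mod M N" using assms by simp
  then obtain k where "k < N" "dg x k \<noteq> dg t k" using mod_eq_iff_dg by blast
  then show ?thesis using False dirichlet_M_eq_0 by simp
qed

end

section \<open>Norlund means on a finite level\<close>

text \<open>Abel summation writes the sum as a combination of the initial sums of \<open>S\<close>
  with nonnegative coefficients. Inserting \<open>real J * \<Lambda>\<close> for each of them and
  summing back by parts recovers the total weight.\<close>

lemma norm_Abel_sum_le:
  fixes S :: "nat \<Rightarrow> complex"
  assumes T: "\<And>J. J \<le> n \<Longrightarrow> norm (\<Sum>k<J. S k) \<le> real J * \<Lambda>"
    and w: "\<And>i j. i \<le> j \<Longrightarrow> j < n \<Longrightarrow> w j \<le> w i" "\<And>i. i < n \<Longrightarrow> w i \<ge> (0::real)"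
  shows "norm (\<Sum>k<n. of_real (w k) * S k) \<le> (\<Sum>k<n. w k) * \<Lambda>"
proof (cases n)
  case (Suc n')
  \<comment> \<open>With the boundary term subtracted, the induction step adds exactly
    \<open>w j - w (Suc j)\<close> times one initial sum.\<close>
  have "norm ((\<Sum>k<Suc j. of_real (w k) * S k) - of_real (w j) * (\<Sum>k<Suc j. S k))
        \<le> \<Lambda> * ((\<Sum>k<Suc j. w k) - real (Suc j) * w j)" if "j < n" for j
    using that
  proof (induction j)
    case (Suc j)
    define A where "A = (\<Sum>k<Suc j. of_real (w k) * S k)"
    define T' where "T' = (\<Sum>k<Suc j. S k)"
    have d: "w j - w (Suc j) \<ge> 0" using w(1)[of j "Suc j"] Suc.prems by simp
    have "(\<Sum>k<Suc (Suc j). of_real (w k) * S k) - of_real (w (Suc j)) * (\<Sum>k<Suc (Suc j). S k)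
        = (A - of_real (w j) * T') + of_real (w j - w (Suc j)) * T'"
      unfolding sum.lessThan_Suc[of _ "Suc j"] A_def T'_def by (simp add: algebra_simps)
    also have "norm \<dots>
        \<le> \<Lambda> * ((\<Sum>k<Suc j. w k) - real (Suc j) * w j) + (w j - w (Suc j)) * (real (Suc j) * \<Lambda>)"
    proof (rule norm_triangle_mono)
      show "norm (A - of_real (w j) * T') \<le> \<Lambda> * ((\<Sum>k<Suc j. w k) - real (Suc j) * w j)"
        using Suc unfolding A_def T'_def by simp
      have "norm T' \<le> real (Suc j) * \<Lambda>" unfolding T'_def using T[of "Suc j"] Suc.prems by simp
      then show "norm (of_real (w j - w (Suc j)) * T') \<le> (w j - w (Suc j)) * (real (Suc j) * \<Lambda>)"
        using d by (simp only: norm_mult norm_of_real abs_of_nonneg) (intro mult_left_mono)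
    qed
    also have "\<dots> = \<Lambda> * ((\<Sum>k<Suc (Suc j). w k) - real (Suc (Suc j)) * w (Suc j))"
      by (simp add: algebra_simps)
    finally show ?case .
  qed simp
  from this[of n'] have 1: "norm ((\<Sum>k<n. of_real (w k) * S k) - of_real (w n') * (\<Sum>k<n. S k))
        \<le> \<Lambda> * ((\<Sum>k<n. w k) - real n * w n')" using Suc by simp
  have 2: "norm (of_real (w n') * (\<Sum>k<n. S k)) \<le> w n' * (real n * \<Lambda>)"
    using T[of n] w(2)[of n'] Suc
    by (simp only: norm_mult norm_of_real abs_of_nonneg) (intro mult_left_mono, auto)
  have "norm (\<Sum>k<n. of_real (w k) * S k)
      \<le> \<Lambda> * ((\<Sum>k<n. w k) - real n * w n') + w n' * (real n * \<Lambda>)"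
    using norm_triangle_mono[OF 1 2] by simp
  then show ?thesis by (simp add: algebra_simps)
qed simp

section \<open>Fourier analysis on the cells of level \<open>N\<close>\<close>

context vilenkin_group
begin

lemma card_cell:
  assumes "L \<le> N" "u < M L"
  shows "real (card {c. c < M N \<and> c mod M L = u}) = real (M N) / real (M L)"
proof -
  obtain r where r: "M N = r * M L" using M_dvd[OF assms(1)] by (metis dvdE mult.commute)
  have "card {c. c < M N \<and> c mod M L = u} = (\<Sum>c | c < r * M L \<and> c mod M L = u. 1)"
    using r by simp
  also have "\<dots> = r" by (subst sum_cell[OF assms(2)]) simp
  finally show ?thesis using r by (simp add: field_simps)
qed

text \<open>The symmetry of \<open>chi\<close> turns \<open>dirichlet_M_orth\<close>, a sum over
  indices, into a sum over cells.\<close>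

lemma chi_orth:
  assumes "i < M N" "j < M N"
  shows "(\<Sum>c<M N. chi N i c * cnj (chi N j c)) = (if i = j then of_nat (M N) else 0)"
  using dirichlet_M_orth[OF assms] by (simp add: dirichlet_def pair_char_def chi_commute)

definition coeff :: "nat \<Rightarrow> (nat \<Rightarrow> complex) \<Rightarrow> nat \<Rightarrow> complex" where
  "coeff N F i = (\<Sum>c<M N. F c * cnj (chi N i c)) / of_nat (M N)"

definition fourier_sum :: "nat \<Rightarrow> (nat \<Rightarrow> complex) \<Rightarrow> nat \<Rightarrow> nat \<Rightarrow> complex" where
  "fourier_sum N F j x = (\<Sum>i<j. coeff N F i * chi N i x)"

lemma fourier_sum_eq_dirichlet: "fourier_sum N F j x
    = (\<Sum>c<M N. F c * dirichlet N x c j) / of_nat (M N)"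
proof -
  have "fourier_sum N F j x = (\<Sum>i<j. \<Sum>c<M N. F c * pair_char N x c i) / of_nat (M N)"
    by (simp add: fourier_sum_def coeff_def pair_char_def sum_divide_distrib sum_distrib_right sum_distrib_left mult_ac)
  also have "(\<Sum>i<j. \<Sum>c<M N. F c * pair_char N x c i) = (\<Sum>c<M N. F c * dirichlet N x c j)"
    by (subst sum.swap) (simp add: dirichlet_def sum_distrib_left)
  finally show ?thesis .
qed

text \<open>The argument is \<open>Suc J\<close> because \<open>dirichlet_sum\<close> starts at the
  kernel of order 0, which is 0; orders 1 to \<open>J\<close> remain.\<close>

lemma sum_fourier_sum_eq_dirichlet_sum: "(\<Sum>k<J. fourier_sum N F (Suc k) x)
    = (\<Sum>c<M N. F c * dirichlet_sum N x c (Suc J)) / of_nat (M N)"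
proof -
  have G: "dirichlet_sum N x c (Suc J) = (\<Sum>k<J. dirichlet N x c (Suc k))" for c
    unfolding dirichlet_sum_def by (subst sum.lessThan_Suc_shift) (simp add: dirichlet_def)
  show ?thesis
    unfolding fourier_sum_eq_dirichlet sum_divide_distrib[symmetric] G
    by (subst sum.swap) (simp add: sum_distrib_left)
qed

text \<open>For \<open>j \<le> M N\<close> the characters involved are orthogonal, so the partial
  sum is an orthogonal projection: \<open>F - ?P\<close> is orthogonal to \<open>?P\<close>, and
  Pythagoras applies.\<close>

lemma Bessel:
  assumes "j \<le> M N"
  shows "(\<Sum>x<M N. (norm (fourier_sum N F j x))\<^sup>2) \<le> (\<Sum>x<M N. (norm (F x))\<^sup>2)"
proof -
  let ?P = "fourier_sum N F j" and ?a = "coeff N F"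
  have PG: "(\<Sum>x<M N. G x * cnj (?P x)) = (\<Sum>i<j. cnj (?a i) * (\<Sum>x<M N. G x * cnj (chi N i x)))" for G
    by (simp add: fourier_sum_def sum_distrib_left mult_ac) (rule sum.swap)
  have "(\<Sum>x<M N. ?P x * cnj (chi N i x)) = of_nat (M N) * ?a i" if "i < j" for i
  proof -
    have "(\<Sum>x<M N. ?P x * cnj (chi N i x)) = (\<Sum>l<j. ?a l * (\<Sum>x<M N. chi N l x * cnj (chi N i x)))"
      by (simp add: fourier_sum_def sum_distrib_left sum_distrib_right mult_ac) (rule sum.swap)
    also have "\<dots> = (\<Sum>l<j. if l = i then of_nat (M N) * ?a i else 0)"
      using assms that by (intro sum.cong refl) (auto simp: chi_orth)
    finally show ?thesis using that by simp
  qed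
  moreover have "(\<Sum>x<M N. F x * cnj (chi N i x)) = of_nat (M N) * ?a i" for i
    by (simp add: coeff_def)
  ultimately have eq: "(\<Sum>x<M N. F x * cnj (?P x)) = (\<Sum>x<M N. ?P x * cnj (?P x))"
    unfolding PG by (intro sum.cong refl) auto
  have "0 \<le> (\<Sum>x<M N. (norm (F x - ?P x))\<^sup>2)" by (simp add: sum_nonneg)
  also have "\<dots> = (\<Sum>x<M N. (norm (F x))\<^sup>2) - (\<Sum>x<M N. (norm (?P x))\<^sup>2)"
  proof -
    have "complex_of_real (\<Sum>x<M N. (norm (F x - ?P x))\<^sup>2) =
      (\<Sum>x<M N. F x * cnj (F x)) - (\<Sum>x<M N. F x * cnj (?P x))
        - cnj (\<Sum>x<M N. F x * cnj (?P x)) + (\<Sum>x<M N. ?P x * cnj (?P x))"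
      unfolding of_real_sum complex_norm_square
      by (simp add: algebra_simps sum.distrib sum_subtractf)
    also have "\<dots> = (\<Sum>x<M N. F x * cnj (F x)) - (\<Sum>x<M N. ?P x * cnj (?P x))"
      unfolding eq by (simp add: mult.commute)
    also have "\<dots> = complex_of_real ((\<Sum>x<M N. (norm (F x))\<^sup>2) - (\<Sum>x<M N. (norm (?P x))\<^sup>2))"
      unfolding of_real_diff of_real_sum complex_norm_square ..
    finally show ?thesis unfolding of_real_eq_iff .
  qed
  finally show ?thesis by simp
qed

end

section \<open>Norlund means with non-decreasing weights\<close>

locale vilenkin_norlund = vilenkin_group +
  fixes q :: "nat \<Rightarrow> real"
  assumes q_mono: "mono q" and q_nonneg: "\<And>k. 0 \<le> q k" and q_0: "0 < q 0"
begin

definition norlund :: "nat \<Rightarrow> (nat \<Rightarrow> complex) \<Rightarrow> nat \<Rightarrow> nat \<Rightarrow> complex" where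
  "norlund N F n x = (1 / of_real (norlund_Q q n))
      * (\<Sum>k=1..n. of_real (q (n - k)) * fourier_sum N F k x)"

lemma Q_pos: "n > 0 \<Longrightarrow> norlund_Q q n > 0"
  using q_nonneg q_0 unfolding norlund_Q_def by (intro sum_pos2[of _ 0]) auto

lemma norlund_eq: "norlund N F n x
    = (\<Sum>k<n. of_real (q (n - Suc k)) * fourier_sum N F (Suc k) x) / of_real (norlund_Q q n)"
  by (simp add: norlund_def sum.atLeast1_atMost_eq)

lemma Q_eq: "(\<Sum>k<n. q (n - Suc k)) = norlund_Q q n"
  unfolding norlund_Q_def by (rule sum.nat_diff_reindex)

lemma norlund_0 [simp]: "norlund N F 0 x = 0"
  by (simp add: norlund_def)

lemma norlund_sum: "norlund N (\<lambda>c. \<Sum>i\<in>I. F i c) n x = (\<Sum>i\<in>I. norlund N (F i) n x)"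
proof -
  have "fourier_sum N (\<lambda>c. \<Sum>i\<in>I. F i c) k x = (\<Sum>i\<in>I. fourier_sum N (F i) k x)" for k
    unfolding fourier_sum_eq_dirichlet sum_distrib_right by (subst sum.swap) (simp add: sum_divide_distrib)
  then show ?thesis
    unfolding norlund_eq by (simp add: sum_distrib_left sum_divide_distrib) (rule sum.swap)
qed

text \<open>The weights \<open>q (n - Suc k)\<close> are non-increasing in \<open>k\<close> and add
  up to \<open>norlund_Q q n\<close>, so Abel summation passes a bound for the Fejer sums on to the
  mean without loss.\<close>

lemma norm_norlund_le:
  assumes "\<And>J. J \<le> n \<Longrightarrow> norm (\<Sum>k<J. fourier_sum N F (Suc k) x) \<le> real J * \<Lambda>" "\<Lambda> \<ge> 0"
  shows "norm (norlund N F n x) \<le> \<Lambda>"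
proof (cases "n = 0")
  case False
  have "norm (\<Sum>k<n. of_real (q (n - Suc k)) * fourier_sum N F (Suc k) x)
      \<le> (\<Sum>k<n. q (n - Suc k)) * \<Lambda>"
    by (intro norm_Abel_sum_le assms monoD[OF q_mono] q_nonneg) auto
  then show ?thesis
    using Q_pos[of n] False unfolding norlund_eq Q_eq by (simp add: norm_divide field_simps)
qed (use assms in simp)

text \<open>The mean is a convex combination of partial sums, each contractive in L^2 by
  \<open>Bessel\<close>; convexity of the square does the rest.\<close>

lemma norlund_L2:
  assumes "n \<le> M N"
  shows "(\<Sum>x<M N. (norm (norlund N F n x))\<^sup>2) \<le> (\<Sum>x<M N. (norm (F x))\<^sup>2)"
proof (cases "n = 0")
  case False
  define w where "w k = q (n - Suc k) / norlund_Q q n" for k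
  have w: "w k \<ge> 0" for k using q_nonneg Q_pos[of n] False by (simp add: w_def)
  have w1: "(\<Sum>k<n. w k) = 1"
    using Q_pos[of n] False by (simp add: w_def sum_divide_distrib[symmetric] Q_eq)
  have "(norm (norlund N F n x))\<^sup>2 \<le> (\<Sum>k<n. w k * (norm (fourier_sum N F (Suc k) x))\<^sup>2)" for x
  proof -
    have "norm (norlund N F n x) = norm (\<Sum>k<n. of_real (w k) * fourier_sum N F (Suc k) x)"
      by (simp add: norlund_eq w_def sum_divide_distrib)
    also have "\<dots> \<le> (\<Sum>k<n. w k *\<^sub>R norm (fourier_sum N F (Suc k) x))"
      by (rule order_trans[OF norm_sum]) (simp add: norm_mult w)
    finally have "(norm (norlund N F n x))\<^sup>2 \<le> (\<Sum>k<n. w k *\<^sub>R norm (fourier_sum N F (Suc k) x))\<^sup>2"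
      by (intro power_mono) auto
    also have "\<dots> \<le> (\<Sum>k<n. w k * (norm (fourier_sum N F (Suc k) x))\<^sup>2)"
      using False by (intro convex_on_sum[OF _ _ convex_power2] w w1) auto
    finally show ?thesis .
  qed
  then have "(\<Sum>x<M N. (norm (norlund N F n x))\<^sup>2)
      \<le> (\<Sum>x<M N. \<Sum>k<n. w k * (norm (fourier_sum N F (Suc k) x))\<^sup>2)" by (intro sum_mono)
  also have "\<dots> = (\<Sum>k<n. w k * (\<Sum>x<M N. (norm (fourier_sum N F (Suc k) x))\<^sup>2))"
    by (subst sum.swap) (simp add: sum_distrib_left)
  also have "\<dots> \<le> (\<Sum>k<n. w k * (\<Sum>x<M N. (norm (F x))\<^sup>2))"
    using assms by (intro sum_mono mult_left_mono Bessel w) auto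
  also have "\<dots> = (\<Sum>x<M N. (norm (F x))\<^sup>2)" by (simp add: sum_distrib_right[symmetric] w1)
  finally show ?thesis .
qed (simp add: sum_nonneg)

end

section \<open>Points that differ from a cell in at most one digit\<close>

definition near :: "(nat \<Rightarrow> nat) \<Rightarrow> nat \<Rightarrow> nat \<Rightarrow> nat \<Rightarrow> bool" where
  "near m u l x \<longleftrightarrow> card {j. j < l \<and> vil_digit m x j \<noteq> vil_digit m u j} \<le> 1"

context vilenkin_group
begin

lemma near_mod: "near m u l (x mod M l) = near m u l x"
proof -
  have "{j. j < l \<and> dg (x mod M l) j \<noteq> dg u j} = {j. j < l \<and> dg x j \<noteq> dg u j}"
    by (auto simp: dg_mod)
  then show ?thesis by (simp add: near_def)
qed

lemma near_Suc:
  assumes "near m u (Suc l) x"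
  shows "(near m u l x \<and> dg x l = dg u l) \<or> x mod M l = u mod M l"
proof (cases "dg x l = dg u l")
  case True
  then have "{j. j < Suc l \<and> dg x j \<noteq> dg u j} = {j. j < l \<and> dg x j \<noteq> dg u j}"
    by (auto simp: less_Suc_eq)
  then show ?thesis using assms True by (simp add: near_def)
next
  case False
  then have "{j. j < Suc l \<and> dg x j \<noteq> dg u j} = insert l {j. j < l \<and> dg x j \<noteq> dg u j}"
    by (auto simp: less_Suc_eq)
  then have "{j. j < l \<and> dg x j \<noteq> dg u j} = {}" using assms by (simp add: near_def)
  then show ?thesis using mod_eq_iff_dg by auto
qed

text \<open>The level \<open>l\<close> at which nearness is lost is the position of the second digit
  differing from \<open>u\<close>, so the kernel bound for two differing digits becomes
  available.\<close>

lemma not_near_Suc: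
  assumes "near m u l x" "\<not> near m u (Suc l) x"
  obtains k where "k < l" "dg x k \<noteq> dg u k" "dg x l \<noteq> dg u l"
proof -
  let ?A = "{j. j < l \<and> dg x j \<noteq> dg u j}"
  have ne: "dg x l \<noteq> dg u l"
  proof
    assume "dg x l = dg u l"
    then have "{j. j < Suc l \<and> dg x j \<noteq> dg u j} = ?A" by (auto simp: less_Suc_eq)
    then show False using assms by (simp add: near_def)
  qed
  then have "{j. j < Suc l \<and> dg x j \<noteq> dg u j} = insert l ?A" by (auto simp: less_Suc_eq)
  then have "?A \<noteq> {}" using assms by (auto simp: near_def)
  then show ?thesis using that ne by auto
qed

text \<open>Passing to level \<open>Suc l\<close> either copies the digit of \<open>u\<close> or,
  when all lower digits agree with \<open>u\<close>, leaves at most \<open>B\<close> choices. The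
  count thus grows linearly, against exponential growth of \<open>M l\<close>.\<close>

lemma card_near_M: "card {x. x < M l \<and> near m u l x} \<le> 1 + l * B"
proof (induction l)
  case 0
  have "{x. x < M 0 \<and> near m u 0 x} \<subseteq> {0}" by auto
  then show ?case using card_mono[of "{0::nat}"] by fastforce
next
  case (Suc l)
  let ?A = "{x. x < M l \<and> near m u l x}"
  have "{x. x < M (Suc l) \<and> near m u (Suc l) x} \<subseteq>
      (\<lambda>b. dg u l * M l + b) ` ?A \<union> (\<lambda>v. v * M l + u mod M l) ` {..<m l}"
  proof
    fix x assume x: "x \<in> {x. x < M (Suc l) \<and> near m u (Suc l) x}"
    have xe: "x = dg x l * M l + x mod M l" using x mod_M_Suc[of x l] by simp
    from x have "(near m u l x \<and> dg x l = dg u l) \<or> x mod M l = u mod M l" using near_Suc by blast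
    then show "x \<in> (\<lambda>b. dg u l * M l + b) ` ?A \<union> (\<lambda>v. v * M l + u mod M l) ` {..<m l}"
    proof
      assume a: "near m u l x \<and> dg x l = dg u l"
      then have "x mod M l \<in> ?A" using near_mod by simp
      moreover have "x = dg u l * M l + x mod M l" using xe a by simp
      ultimately show ?thesis by blast
    next
      assume "x mod M l = u mod M l"
      then have "x = dg x l * M l + u mod M l" using xe by simp
      then show ?thesis using dg_less[of x l] by blast
    qed
  qed
  then have "card {x. x < M (Suc l) \<and> near m u (Suc l) x} \<le>
      card ((\<lambda>b. dg u l * M l + b) ` ?A \<union> (\<lambda>v. v * M l + u mod M l) ` {..<m l})"
    by (intro card_mono) auto
  also have "\<dots> \<le> card ?A + card {..<m l}"
    by (intro order_trans[OF card_Un_le] add_mono card_image_le) auto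
  also have "\<dots> \<le> 1 + l * B + B" using Suc m_le[of l] by simp
  finally show ?case by simp
qed

lemma card_near:
  assumes "l \<le> N"
  shows "real (card {x. x < M N \<and> near m u l x})
      \<le> (1 + real l * real B) * (real (M N) / real (M l))"
proof -
  let ?V = "{x. x < M l \<and> near m u l x}"
  have "{x. x < M N \<and> near m u l x} \<subseteq> (\<Union>v\<in>?V. {c. c < M N \<and> c mod M l = v})"
    by (auto simp: near_mod)
  then have "card {x. x < M N \<and> near m u l x} \<le> card (\<Union>v\<in>?V. {c. c < M N \<and> c mod M l = v})"
    by (intro card_mono) auto
  also have "\<dots> \<le> (\<Sum>v\<in>?V. card {c. c < M N \<and> c mod M l = v})"
    by (intro card_UN_le) auto
  finally have "real (card {x. x < M N \<and> near m u l x})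
      \<le> (\<Sum>v\<in>?V. real (card {c. c < M N \<and> c mod M l = v}))"
    by (simp flip: of_nat_sum)
  also have "\<dots> = real (card ?V) * (real (M N) / real (M l))"
    using assms by (simp add: card_cell)
  also have "\<dots> \<le> (1 + real l * real B) * (real (M N) / real (M l))"
    using card_near_M[of l u] by (intro mult_right_mono) (simp_all flip: of_nat_mult of_nat_Suc)
  finally show ?thesis .
qed

end

section \<open>Atoms\<close>

text \<open>Comparison with an integral: the mean value theorem bounds each term by a difference of
  values of \<open>real n powr (1 - s)\<close>, and these telescope.\<close>

lemma sum_powr_tail_le:
  fixes s :: real
  assumes s: "s > 1" and a: "a \<ge> 1"
  shows "(\<Sum>n=a..K. real n powr (- s)) \<le> 2 powr s / (s - 1) * real a powr (1 - s)"
proof -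
  have step: "real n powr (- s)
      \<le> 2 powr s / (s - 1) * (real n powr (1 - s) - real (Suc n) powr (1 - s))"
    if n: "n \<ge> 1" for n
  proof -
    have "\<exists>z. real n < z \<and> z < real (Suc n) \<and>
        real (Suc n) powr (1 - s) - real n powr (1 - s) = (real (Suc n) - real n) * ((1 - s) * z powr (1 - s - 1))"
      using n by (intro MVT2 has_real_derivative_powr) auto
    then obtain z where z: "real n < z" "z < real (Suc n)"
      and eq: "real n powr (1 - s) - real (Suc n) powr (1 - s) = (s - 1) * z powr (- s)"
      by (auto simp: algebra_simps)
    \<comment> \<open>Here \<open>z < n + 1 \<le> 2 * n\<close>, the origin of the factor
      \<open>2 powr s\<close>.\<close>
    have "(2 * real n) powr (- s) \<le> z powr (- s)"
      using z n s by (intro powr_mono2') auto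
    then have "2 powr s * (2 powr (- s) * real n powr (- s)) \<le> 2 powr s * z powr (- s)"
      by (intro mult_left_mono) (auto simp: powr_mult)
    then have "real n powr (- s) \<le> 2 powr s * z powr (- s)"
      by (simp add: powr_minus field_simps)
    then show ?thesis unfolding eq using s by simp
  qed
  have "(\<Sum>n=a..K. real n powr (- s))
      \<le> 2 powr s / (s - 1) * (real a powr (1 - s) - real (Suc K) powr (1 - s))"
    if "a \<le> Suc K"
    using that
  proof (induction K rule: nat_induct)
    case 0
    then show ?case using step[of 1] a by (cases "a = 1") auto
  next
    case (Suc K)
    show ?case
    proof (cases "a = Suc (Suc K)")
      case True
      then show ?thesis by simp
    next
      case False
      then have "(\<Sum>n=a..Suc K. real n powr (- s))
          = (\<Sum>n=a..K. real n powr (- s)) + real (Suc K) powr (- s)"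
        using Suc.prems by simp
      also have "\<dots> \<le> 2 powr s / (s - 1) * (real a powr (1 - s) - real (Suc K) powr (1 - s))
         + 2 powr s / (s - 1) * (real (Suc K) powr (1 - s) - real (Suc (Suc K)) powr (1 - s))"
        using Suc False by (intro add_mono step) auto
      finally show ?thesis by (simp add: algebra_simps)
    qed
  qed
  moreover have "2 powr s / (s - 1) * (real a powr (1 - s) - real (Suc K) powr (1 - s))
      \<le> 2 powr s / (s - 1) * real a powr (1 - s)"
    using s by (intro mult_left_mono) auto
  moreover have "(\<Sum>n=a..K. real n powr (- s)) \<le> 2 powr s / (s - 1) * real a powr (1 - s)"
    if "\<not> a \<le> Suc K"
    using that s by simp
  ultimately show ?thesis by linarith
qed

text \<open>A fraction \<open>c / (a + b)\<close> of at most 1 does not exceed its own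
  \<open>p\<close>-th power, and the two fractions add up to 1.\<close>

lemma powr_add_le:
  fixes a b p :: real
  assumes "0 \<le> a" "0 \<le> b" "0 < p" "p \<le> 1"
  shows "(a + b) powr p \<le> a powr p + b powr p"
proof (cases "a + b = 0")
  case False
  then have ab: "a + b > 0" using assms by simp
  have *: "c / (a + b) * (a + b) powr p \<le> c powr p" if "0 \<le> c" "c \<le> a + b" for c
  proof -
    have "c / (a + b) \<le> (c / (a + b)) powr p"
      using powr_mono'[of p 1 "c / (a + b)"] that ab assms by (simp add: powr_one_gt_zero_iff)
    then have "c / (a + b) * (a + b) powr p \<le> (c / (a + b)) powr p * (a + b) powr p"
      by (intro mult_right_mono) auto
    also have "\<dots> = c powr p"
      using that ab by (simp add: powr_mult[symmetric])
    finally show ?thesis .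
  qed
  have "(a + b) powr p = a / (a + b) * (a + b) powr p + b / (a + b) * (a + b) powr p"
    using ab by (simp add: distrib_right[symmetric] add_divide_distrib[symmetric])
  also have "\<dots> \<le> a powr p + b powr p" using assms by (intro add_mono *) auto
  finally show ?thesis .
qed (use assms in auto)

lemma norm_sum_powr_le:
  fixes f :: "'i \<Rightarrow> complex"
  assumes "finite I" "0 < p" "p \<le> 1"
  shows "norm (\<Sum>i\<in>I. f i) powr p \<le> (\<Sum>i\<in>I. norm (f i) powr p)"
  using assms(1)
proof induction
  case (insert i I)
  have "norm (\<Sum>i\<in>insert i I. f i) powr p \<le> (norm (f i) + norm (\<Sum>i\<in>I. f i)) powr p"
    using insert assms by (intro powr_mono2) (auto intro: norm_triangle_ineq)
  also have "\<dots> \<le> norm (f i) powr p + norm (\<Sum>i\<in>I. f i) powr p"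
    using assms by (intro powr_add_le) auto
  finally show ?case using insert by simp
qed simp

text \<open>A crude substitute for the inequality of Hoelder: \<open>p\<close>-th powers on a set
  are controlled by its size and an L^2 norm.\<close>

lemma powr_le_1_plus_square:
  fixes y p :: real
  assumes "0 \<le> y" "0 < p" "p \<le> 2"
  shows "y powr p \<le> 1 + y\<^sup>2"
proof (cases "y \<le> 1")
  case True
  then have "y powr p \<le> 1" using assms by (simp add: powr_le1)
  then show ?thesis using zero_le_power2[of y] by linarith
next
  case False
  then have "y powr p \<le> y powr 2" using assms by (intro powr_mono) auto
  also have "\<dots> = y\<^sup>2" using False by (subst powr_numeral) auto
  finally show ?thesis by simp
qed

section \<open>The constants of the final estimate\<close>

context vilenkin_group
begin

definition C_series :: "real \<Rightarrow> real" where
  "C_series p = (2 + real B) / (1 - 2 powr (2 * p - 1))\<^sup>2"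

text \<open>As \<open>M l\<close> is at least \<open>2 ^ l\<close>, the sum is dominated by the
  derivative of the geometric series with ratio \<open>2 powr (2 * p - 1)\<close>, which is below 1
  by \<open>p < 1/2\<close>.\<close>

lemma sum_C_series:
  assumes "p < 1/2"
  shows "(\<Sum>l<n. (2 + real l * real B) * real (M l) powr (2 * p - 1)) \<le> C_series p"
proof -
  define r where "r = (2::real) powr (2 * p - 1)"
  have r: "0 < r" "r < 1" using assms by (auto simp: r_def powr_less_one)
  have "(\<Sum>l<n. (2 + real l * real B) * real (M l) powr (2 * p - 1))
      \<le> (\<Sum>l<n. (2 + real B) * (of_nat (Suc l) * r ^ l))"
  proof (rule sum_mono)
    fix l
    have "real (M l) powr (2 * p - 1) \<le> (2 ^ l) powr (2 * p - 1)"
      using assms power2_le_M[of l] by (intro powr_mono2') (auto simp flip: of_nat_power_le_of_nat_cancel_iff)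
    also have "\<dots> = r ^ l"
      by (simp add: r_def powr_powr powr_realpow[symmetric] mult.commute)
    finally have 1: "real (M l) powr (2 * p - 1) \<le> r ^ l" .
    have 2: "2 + real l * real B \<le> (2 + real B) * real (Suc l)"
      by (simp add: algebra_simps)
    show "(2 + real l * real B) * real (M l) powr (2 * p - 1)
        \<le> (2 + real B) * (of_nat (Suc l) * r ^ l)"
      unfolding mult.assoc[symmetric] using 1 2 r by (intro mult_mono) auto
  qed
  also have "\<dots> = (2 + real B) * (\<Sum>l<n. of_nat (Suc l) * r ^ l)" by (simp add: sum_distrib_left)
  also have "\<dots> \<le> (2 + real B) * (1 / (1 - r)\<^sup>2)"
  proof (intro mult_left_mono)
    have s: "(\<lambda>n. of_nat (Suc n) * r ^ n) sums (1 / (1 - r)\<^sup>2)"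
      using geometric_deriv_sums[of r] r by simp
    show "(\<Sum>l<n. of_nat (Suc l) * r ^ l) \<le> 1 / (1 - r)\<^sup>2"
      unfolding sums_unique[OF s] using r by (intro sum_le_suminf sums_summable[OF s]) auto
  qed simp
  finally show ?thesis by (simp add: C_series_def r_def)
qed

lemma C_series_term:
  assumes "p < 1/2"
  shows "(2 + real L * real B) * real (M L) powr (2 * p - 1) \<le> C_series p"
proof -
  have "(2 + real L * real B) * real (M L) powr (2 * p - 1)
      \<le> (\<Sum>l<Suc L. (2 + real l * real B) * real (M l) powr (2 * p - 1))"
    by (intro member_le_sum) auto
  also have "\<dots> \<le> C_series p" by (rule sum_C_series[OF assms])
  finally show ?thesis .
qed

text \<open>The summand 1 pays for the near points, \<open>real B powr (2 * p)\<close> for the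
  others, where \<open>M (Suc l)\<close> is replaced by \<open>B\<close> times
  \<open>M l\<close>.\<close>

definition C_atom :: "real \<Rightarrow> real" where
  "C_atom p = (1 + real B powr (2 * p)) * C_series p"

definition C_atom_sum :: "real \<Rightarrow> real" where
  "C_atom_sum p = C_atom p * (2 powr (2 - 2 * p) / (1 - 2 * p))"

lemma C_atom_nonneg: "C_atom p \<ge> 0"
  by (simp add: C_atom_def C_series_def)

text \<open>The factor \<open>3 powr p\<close> comes from the height of the atoms, \<open>B\<close>
  from predictable stopping, and the denominator from the geometric sum over dyadic scales.\<close>

definition C_strong :: "real \<Rightarrow> real" where
  "C_strong p = C_atom_sum p * 3 powr p * real B / (1 - 2 powr (- p))"

lemma C_atom_sum_nonneg: "p < 1/2 \<Longrightarrow> C_atom_sum p \<ge> 0"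
  unfolding C_atom_sum_def using C_atom_nonneg[of p] by simp

end

section \<open>Estimates for a single atom\<close>

context vilenkin_norlund
begin

text \<open>The height \<open>\<beta>\<close> is a free parameter instead of being normalized by the
  measure of the cell. At \<open>L = 0\<close> the cell is the whole group and a nonzero mean is
  allowed.\<close>

definition atom :: "nat \<Rightarrow> nat \<Rightarrow> nat \<Rightarrow> real \<Rightarrow> (nat \<Rightarrow> complex) \<Rightarrow> bool" where
  "atom N L u \<beta> a \<longleftrightarrow> L \<le> N \<and> u < M L \<and> 0 < \<beta> \<and>
     (\<forall>c<M N. norm (a c) \<le> \<beta>) \<and> (\<forall>c<M N. c mod M L \<noteq> u \<longrightarrow> a c = 0) \<and>
     (L \<noteq> 0 \<longrightarrow> (\<Sum>c<M N. a c) = 0)"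

text \<open>A character of index below \<open>M L\<close> is constant on the supporting cell, so the
  coefficient is a multiple of the mean of the atom.\<close>

lemma atom_fourier_sum_eq_0:
  assumes at: "atom N L u \<beta> a" and j: "j \<le> M L" "L \<noteq> 0"
  shows "fourier_sum N a j x = 0"
proof -
  have "coeff N a i = 0" if i: "i < j" for i
  proof -
    have "a c * cnj (chi N i c) = a c * cnj (chi N i u)" if "c < M N" for c
      using at that i j chi_mod[of i L N c u] by (cases "c mod M L = u") (auto simp: atom_def)
    then have "(\<Sum>c<M N. a c * cnj (chi N i c)) = (\<Sum>c<M N. a c) * cnj (chi N i u)"
      unfolding sum_distrib_right by (intro sum.cong refl) auto
    then show ?thesis using at j by (simp add: coeff_def atom_def)
  qed
  then show ?thesis by (simp add: fourier_sum_def)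
qed

lemma atom_norlund_eq_0:
  assumes "atom N L u \<beta> a" "n < M L"
  shows "norlund N a n x = 0"
proof (cases "L = 0")
  case False
  then show ?thesis using assms by (simp add: norlund_eq atom_fourier_sum_eq_0)
qed (use assms in simp)

lemma atom_sum_le:
  assumes at: "atom N L u \<beta> a" and g: "\<And>c. c < M N \<Longrightarrow> c mod M L = u \<Longrightarrow> norm (g c) \<le> \<gamma>"
    and "\<gamma> \<ge> 0"
  shows "norm (\<Sum>c<M N. a c * g c) \<le> \<beta> * \<gamma> * (real (M N) / real (M L))"
proof -
  have "norm (\<Sum>c<M N. a c * g c) \<le> (\<Sum>c<M N. if c mod M L = u then \<beta> * \<gamma> else 0)"
    using at g \<open>\<gamma> \<ge> 0\<close>
    by (intro order_trans[OF norm_sum] sum_mono) (auto simp: norm_mult atom_def intro!: mult_mono)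
  also have "\<dots> = (\<Sum>c | c < M N \<and> c mod M L = u. \<beta> * \<gamma>)"
    by (subst sum.inter_filter[symmetric]) auto
  also have "\<dots> = \<beta> * \<gamma> * (real (M N) / real (M L))"
    using at by (simp add: card_cell atom_def)
  finally show ?thesis .
qed

text \<open>The Fejer sums vanish for \<open>J < M L\<close>; otherwise they are at most the kernel
  bound times the integral of \<open>norm (a c)\<close>, which is at most
  \<open>\<beta> / M L\<close>.\<close>

lemma atom_norlund_le:
  assumes at: "atom N L u \<beta> a" and x: "near m u l x" "\<not> near m u (Suc l) x" "l < L"
  shows "norm (norlund N a n x) \<le> \<beta> * (real (M (Suc l)) / real (M L))\<^sup>2"
proof (rule norm_norlund_le)
  obtain k where k: "k < l" "dg x k \<noteq> dg u k" "dg x l \<noteq> dg u l" using not_near_Suc x by blast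
  have \<beta>: "\<beta> > 0" and L: "L \<le> N" and u: "u < M L" using at by (auto simp: atom_def)
  let ?P = "real (M (Suc l))"
  show "0 \<le> \<beta> * (?P / real (M L))\<^sup>2" using \<beta> by simp
  fix J
  show "norm (\<Sum>k<J. fourier_sum N a (Suc k) x) \<le> real J * (\<beta> * (?P / real (M L))\<^sup>2)"
  proof (cases "J < M L")
    case True
    have "(\<Sum>k<J. fourier_sum N a (Suc k) x) = 0"
      using True at x by (intro sum.neutral) (auto intro!: atom_fourier_sum_eq_0)
    then show ?thesis using \<beta> by simp
  next
    case False
    have "norm (\<Sum>c<M N. a c * dirichlet_sum N x c (Suc J)) \<le> \<beta> * ?P\<^sup>2 * (real (M N) / real (M L))"
    proof (rule atom_sum_le[OF at])
      fix c assume "c < M N" "c mod M L = u"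
      then have "dg c k = dg u k" "dg c l = dg u l"
        using mod_eq_iff_dg[of c L u] u k x by auto
      then show "norm (dirichlet_sum N x c (Suc J)) \<le> ?P\<^sup>2"
        using k x L by (intro norm_dirichlet_sum_le[of k]) auto
    qed simp
    then have "norm (\<Sum>k<J. fourier_sum N a (Suc k) x) \<le> \<beta> * ?P\<^sup>2 / real (M L)"
      unfolding sum_fourier_sum_eq_dirichlet_sum by (simp add: norm_divide field_simps)
    also have "\<dots> = real (M L) * (\<beta> * (?P / real (M L))\<^sup>2)"
      by (simp add: power2_eq_square field_simps)
    \<comment> \<open>Abel summation asks for a bound linear in \<open>J\<close>, which
      \<open>M L \<le> J\<close> supplies.\<close>
    also have "\<dots> \<le> real J * (\<beta> * (?P / real (M L))\<^sup>2)"
      using False \<beta> by (intro mult_right_mono) auto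
    finally show ?thesis .
  qed
qed

text \<open>Points still near at level \<open>L\<close> are handled in L^2, the others by the
  pointwise bound at the level where nearness is lost. The scarcity of near points keeps the sum
  over these levels bounded.\<close>

lemma atom_norlund_Lp:
  assumes at: "atom N L u \<beta> a" and n: "n \<le> M N" and p: "0 < p" "p < 1/2"
  shows "(\<Sum>x<M N. norm (norlund N a n x) powr p) \<le>
    C_atom p * \<beta> powr p * (real (M N) / real (M L)) * real (M L) powr (1 - 2 * p)"
proof -
  have \<beta>: "\<beta> > 0" and L: "L \<le> N" and u: "u < M L" using at by (auto simp: atom_def)
  define R where "R = real (M N) / real (M L)"
  define X where "X = real (M L) powr (1 - 2 * p)"
  have R: "R > 0" and X: "X > 0" by (auto simp: R_def X_def)
  let ?t = "\<lambda>x. norm (norlund N a n x)"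
  define w where "w l = \<beta> powr p * (real (M (Suc l)) / real (M L)) powr (2 * p)" for l
  have w: "w l \<ge> 0" for l by (simp add: w_def)
  have pt: "?t x powr p \<le> (if near m u L x then \<beta> powr p else 0) + \<beta> powr p / \<beta>\<^sup>2 * (?t x)\<^sup>2
      + (\<Sum>l<L. if near m u l x then w l else 0)" (is "_ \<le> ?a + ?b + ?c") for x
  proof (cases "near m u L x")
    case True
    have "?t x powr p = \<beta> powr p * (?t x / \<beta>) powr p"
      using \<beta> by (simp add: powr_mult[symmetric])
    also have "\<dots> \<le> \<beta> powr p * (1 + (?t x / \<beta>)\<^sup>2)"
      using \<beta> p by (intro mult_left_mono powr_le_1_plus_square) auto
    also have "\<dots> = ?a + ?b" using True by (simp add: algebra_simps power_divide)
    also have "\<dots> \<le> ?a + ?b + ?c" using w by (simp add: sum_nonneg)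
    finally show ?thesis .
  next
    case False
    have "near m u 0 x" by (simp add: near_def)
    with False obtain l where l: "l < L" "near m u l x" "\<not> near m u (Suc l) x"
      by (metis dec_induct[of 0 L "\<lambda>l. near m u l x"] le0)
    have "?t x powr p \<le> (\<beta> * (real (M (Suc l)) / real (M L))\<^sup>2) powr p"
      using p l by (intro powr_mono2 atom_norlund_le[OF at]) auto
    also have "\<dots> = w l"
      using \<beta> by (simp add: w_def powr_mult powr_powr powr_realpow[symmetric] del: powr_numeral)
    also have "\<dots> \<le> ?c"
      using l w member_le_sum[of l "{..<L}" "\<lambda>l. if near m u l x then w l else 0"] by auto
    also have "\<dots> \<le> ?a + ?b + ?c" by simp
    finally show ?thesis .
  qed
  have sum_near: "(\<Sum>x<M N. if near m u l x then v else 0)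
      \<le> v * ((1 + real l * real B) * (real (M N) / real (M l)))"
    if "l \<le> N" "v \<ge> 0" for l v
  proof -
    have "(\<Sum>x<M N. if near m u l x then v else 0) = v * real (card {x. x < M N \<and> near m u l x})"
      by (subst sum.inter_filter[symmetric]) (auto simp: mult.commute)
    also have "\<dots> \<le> v * ((1 + real l * real B) * (real (M N) / real (M l)))"
      using that by (intro mult_left_mono card_near)
    finally show ?thesis .
  qed
  have sq: "(\<Sum>x<M N. (?t x)\<^sup>2) \<le> \<beta>\<^sup>2 * R"
  proof -
    have "(\<Sum>x<M N. (?t x)\<^sup>2) \<le> (\<Sum>x<M N. (norm (a x))\<^sup>2)" by (rule norlund_L2[OF n])
    also have "\<dots> \<le> (\<Sum>c<M N. if c mod M L = u then \<beta>\<^sup>2 else 0)"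
      using at by (intro sum_mono) (auto simp: atom_def intro!: power_mono)
    also have "\<dots> = (\<Sum>c | c < M N \<and> c mod M L = u. \<beta>\<^sup>2)"
      by (subst sum.inter_filter[symmetric]) auto
    also have "\<dots> = \<beta>\<^sup>2 * R" using L u by (simp add: card_cell R_def)
    finally show ?thesis .
  qed
  \<comment> \<open>Raising 1 to 2 lets near and far points be measured by the same series.\<close>
  have wl: "w l * ((1 + real l * real B) * (real (M N) / real (M l))) \<le>
      \<beta> powr p * R * X * real B powr (2 * p) * ((2 + real l * real B) * real (M l) powr (2 * p - 1))" for l
  proof -
    have "real (M (Suc l)) powr (2 * p) \<le> real B powr (2 * p) * real (M l) powr (2 * p)"
      using p m_le[of l] by (auto simp: M_Suc powr_mult intro!: mult_right_mono powr_mono2)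
    then have "w l \<le> \<beta> powr p
        * (real B powr (2 * p) * real (M l) powr (2 * p) / real (M L) powr (2 * p))"
      unfolding w_def by (intro mult_left_mono) (auto simp: powr_divide intro!: divide_right_mono)
    then have "w l * ((1 + real l * real B) * (real (M N) / real (M l))) \<le>
       \<beta> powr p * (real B powr (2 * p) * real (M l) powr (2 * p) / real (M L) powr (2 * p)) *
        ((2 + real l * real B) * (real (M N) / real (M l)))"
      by (intro mult_mono mult_right_mono) auto
    also have "\<dots> = \<beta> powr p * R * X * real B powr (2 * p)
        * ((2 + real l * real B) * real (M l) powr (2 * p - 1))"
      by (simp add: R_def X_def powr_diff field_simps)
    finally show ?thesis .
  qed
  have "(\<Sum>x<M N. ?t x powr p) \<le> (\<Sum>x<M N. if near m u L x then \<beta> powr p else 0)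
      + \<beta> powr p / \<beta>\<^sup>2 * (\<Sum>x<M N. (?t x)\<^sup>2)
      + (\<Sum>x<M N. \<Sum>l<L. if near m u l x then w l else 0)"
    unfolding sum_distrib_left sum.distrib[symmetric] by (intro sum_mono pt)
  also have "(\<Sum>x<M N. \<Sum>l<L. if near m u l x then w l else 0)
      = (\<Sum>l<L. \<Sum>x<M N. if near m u l x then w l else 0)"
    by (rule sum.swap)
  also have "(\<Sum>x<M N. if near m u L x then \<beta> powr p else 0)
      + \<beta> powr p / \<beta>\<^sup>2 * (\<Sum>x<M N. (?t x)\<^sup>2)
      + (\<Sum>l<L. \<Sum>x<M N. if near m u l x then w l else 0)
    \<le> \<beta> powr p * ((1 + real L * real B) * (real (M N) / real (M L)))
      + \<beta> powr p / \<beta>\<^sup>2 * (\<beta>\<^sup>2 * R)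
      + (\<Sum>l<L. w l * ((1 + real l * real B) * (real (M N) / real (M l))))"
    using L w by (intro add_mono sum_near sum_mono mult_left_mono sq) auto
  \<comment> \<open>The L^2 term contributes \<open>\<beta> powr p * R\<close> once more, turning
    \<open>1 + real L * real B\<close> into \<open>2 + real L * real B\<close>.\<close>
  also have "\<dots> \<le> \<beta> powr p * R * (2 + real L * real B)
      + (\<Sum>l<L. \<beta> powr p * R * X * real B powr (2 * p) * ((2 + real l * real B) * real (M l) powr (2 * p - 1)))"
    unfolding R_def[symmetric] using \<beta> by (intro add_mono sum_mono wl) (simp add: field_simps)
  also have "\<dots> = \<beta> powr p * R * X * ((2 + real L * real B) * real (M L) powr (2 * p - 1)
      + real B powr (2 * p) * (\<Sum>l<L. (2 + real l * real B) * real (M l) powr (2 * p - 1)))"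
  proof -
    \<comment> \<open>Inserting this factor 1 turns the near part into a single term of the
      series.\<close>
    have "X * real (M L) powr (2 * p - 1) = 1" by (simp add: X_def powr_add[symmetric])
    then have "\<beta> powr p * R * (2 + real L * real B) =
        \<beta> powr p * R * (X * real (M L) powr (2 * p - 1)) * (2 + real L * real B)" by simp
    then show ?thesis unfolding sum_distrib_left[symmetric] by (simp only: algebra_simps)
  qed
  also have "\<dots> \<le> \<beta> powr p * R * X * (C_series p + real B powr (2 * p) * C_series p)"
    using R X p by (intro mult_left_mono add_mono C_series_term sum_C_series) auto
  finally show ?thesis unfolding R_def[symmetric] X_def[symmetric] by (simp add: C_atom_def algebra_simps)
qed

text \<open>Terms with \<open>n < M L\<close> vanish, and the tail of the weights from
  \<open>M L\<close> on is of order \<open>M L\<close> to the power \<open>2 * p - 1\<close>, which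
  cancels the growth in \<open>atom_norlund_Lp\<close> exactly.\<close>

lemma atom_sum_norlund_Lp:
  assumes at: "atom N L u \<beta> a" and K: "K \<le> M N" and p: "0 < p" "p < 1/2"
  shows "(\<Sum>n=1..K. real n powr (2 * p - 2) * (\<Sum>x<M N. norm (norlund N a n x) powr p)) \<le>
    C_atom_sum p * \<beta> powr p * (real (M N) / real (M L))"
proof -
  define A where "A = C_atom p * \<beta> powr p * (real (M N) / real (M L))"
  have A: "A \<ge> 0" using C_atom_nonneg[of p] by (simp add: A_def)
  have "(\<Sum>n=1..K. real n powr (2 * p - 2) * (\<Sum>x<M N. norm (norlund N a n x) powr p))
      = (\<Sum>n=M L..K. real n powr (2 * p - 2) * (\<Sum>x<M N. norm (norlund N a n x) powr p))"
    using M_pos[of L] p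
    by (intro sum.mono_neutral_right) (auto simp: atom_norlund_eq_0[OF at] Suc_le_eq simp del: M_pos)
  also have "\<dots> \<le> (\<Sum>n=M L..K. real n powr (2 * p - 2) * (A * real (M L) powr (1 - 2 * p)))"
    using atom_norlund_Lp[OF at _ p] K by (intro sum_mono mult_left_mono) (auto simp: A_def)
  also have "\<dots> = A * real (M L) powr (1 - 2 * p) * (\<Sum>n=M L..K. real n powr (- (2 - 2 * p)))"
    by (simp add: sum_distrib_left mult_ac)
  also have "\<dots> \<le> A * real (M L) powr (1 - 2 * p) *
      (2 powr (2 - 2 * p) / (2 - 2 * p - 1) * real (M L) powr (1 - (2 - 2 * p)))"
    using A p M_pos[of L] by (intro mult_left_mono sum_powr_tail_le) (auto simp: Suc_le_eq simp del: M_pos)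
  also have "\<dots> = A * (2 powr (2 - 2 * p) / (1 - 2 * p))
      * (real (M L) powr (1 - 2 * p) * real (M L) powr (2 * p - 1))"
    by (simp add: algebra_simps)
  also have "real (M L) powr (1 - 2 * p) * real (M L) powr (2 * p - 1) = 1"
    by (simp add: powr_add[symmetric])
  finally show ?thesis by (simp add: A_def C_atom_sum_def mult_ac)
qed

end

section \<open>Stopping time decomposition\<close>

lemma dyadic_iff:
  fixes h :: real and k :: int
  assumes "h > 0"
  shows "2 powr of_int k < h \<and> h \<le> 2 powr of_int (k + 1) \<longleftrightarrow> k = \<lceil>log 2 h\<rceil> - 1"
proof -
  have "2 powr of_int k < h \<longleftrightarrow> of_int k < log 2 h"
    using assms by (simp add: less_log_iff)
  moreover have "h \<le> 2 powr of_int (k + 1) \<longleftrightarrow> log 2 h \<le> of_int (k + 1)"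
    using assms by (subst log_le_iff) auto
  moreover have "of_int k < log 2 h \<and> log 2 h \<le> of_int (k + 1) \<longleftrightarrow> \<lceil>log 2 h\<rceil> = k + 1"
    unfolding ceiling_eq_iff by simp
  ultimately show ?thesis by linarith
qed

text \<open>Counting down from the largest exponent \<open>k0\<close> with
  \<open>2 powr k0 < v\<close> turns the sum into a part of a geometric series.\<close>

lemma sum_dyadic_le:
  fixes v p :: real
  assumes "finite K" "p > 0" "v \<ge> 0"
  shows "(\<Sum>k\<in>K. if 2 powr of_int k < v then (2 powr of_int k) powr p else 0)
      \<le> v powr p / (1 - 2 powr (- p))"
proof (cases "v = 0")
  case True
  then have "(\<Sum>k\<in>K. if 2 powr of_int k < v then (2 powr of_int k) powr p else 0) = 0"
    by (intro sum.neutral) (simp add: not_less)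
  then show ?thesis using True by simp
next
  case False
  then have v: "v > 0" using assms by simp
  define r where "r = (2::real) powr (- p)"
  have r: "0 < r" "r < 1" using assms by (auto simp: r_def powr_less_one)
  define k0 where "k0 = \<lceil>log 2 v\<rceil> - 1"
  have k0: "2 powr of_int k0 < v" using dyadic_iff[OF v, of k0] by (simp add: k0_def)
  let ?K = "{k \<in> K. 2 powr of_int k < v}"
  have le: "k \<le> k0" if "k \<in> ?K" for k
  proof -
    have "of_int k < log 2 v" using that v by (simp add: less_log_iff)
    then show ?thesis unfolding k0_def by linarith
  qed
  have "(\<Sum>k\<in>K. if 2 powr of_int k < v then (2 powr of_int k) powr p else 0)
      = (\<Sum>k\<in>?K. (2 powr of_int k) powr p)"
    using assms(1) by (simp add: sum.inter_filter)
  also have "\<dots> = (\<Sum>k\<in>?K. (2 powr of_int k0) powr p * r ^ nat (k0 - k))"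
  proof (rule sum.cong[OF refl])
    fix k assume "k \<in> ?K"
    then have "real (nat (k0 - k)) = of_int k0 - of_int k" using le[of k] by simp
    then show "(2 powr of_int k) powr p = (2 powr of_int k0) powr p * r ^ nat (k0 - k)"
      using r(1) by (simp add: powr_realpow[symmetric] r_def powr_powr powr_add[symmetric] algebra_simps)
  qed
  also have "\<dots> = (2 powr of_int k0) powr p * (\<Sum>k\<in>?K. r ^ nat (k0 - k))"
    by (simp add: sum_distrib_left)
  also have "(\<Sum>k\<in>?K. r ^ nat (k0 - k)) = (\<Sum>i\<in>(\<lambda>k. nat (k0 - k)) ` ?K. r ^ i)"
  proof (subst sum.reindex)
    show "inj_on (\<lambda>k. nat (k0 - k)) ?K"
    proof (rule inj_onI)
      fix x y assume "x \<in> ?K" "y \<in> ?K" "nat (k0 - x) = nat (k0 - y)"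
      then show "x = y" using le[of x] le[of y] by linarith
    qed
  qed simp
  also have "\<dots> \<le> (\<Sum>i. r ^ i)"
    using r assms(1) by (intro sum_le_suminf) auto
  also have "\<dots> = 1 / (1 - r)" using r by (simp add: suminf_geometric)
  also have "(2 powr of_int k0) powr p * (1 / (1 - r)) \<le> v powr p * (1 / (1 - r))"
    using k0 assms r by (intro mult_right_mono powr_mono2) auto
  finally show ?thesis by (simp add: r_def mult_left_mono)
qed

text \<open>Here \<open>\<phi> n c\<close> stands for the value of the martingale at time
  \<open>n\<close> at the point with the digits of \<open>c\<close>. Measurability becomes
  \<open>phi_mod\<close>, and the martingale property becomes \<open>phi_avg\<close>, an average
  over the \<open>m n\<close> subcells.\<close>

locale vilenkin_martingale = vilenkin_norlund +
  fixes \<phi> :: "nat \<Rightarrow> nat \<Rightarrow> complex" and N :: nat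
  assumes phi_mod: "\<And>n c. \<phi> n (c mod vil_M m n) = \<phi> n c"
    and phi_avg: "\<And>n c. (\<Sum>v<m n. \<phi> (Suc n) (v * vil_M m n + c mod vil_M m n))
        = of_nat (m n) * \<phi> n c"
    and N_pos: "N > 0"
begin

section \<open>The predictable maximal function\<close>

definition sibling_max :: "nat \<Rightarrow> nat \<Rightarrow> real" where
  "sibling_max j c = Max ((\<lambda>v. norm (\<phi> (Suc j) (v * M j + c mod M j))) ` {..<m j})"

text \<open>Replacing \<open>\<phi> (Suc j)\<close> by its maximum over sibling cells makes the stopping rule
  predictable, at the price of a factor \<open>B\<close> in the measure of the stopped set.\<close>
definition pred_max :: "nat \<Rightarrow> nat \<Rightarrow> real" where
  "pred_max L c = Max ((\<lambda>j. sibling_max j c) ` {..L})"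

text \<open>Predictability: values at level \<open>Suc j\<close> are bounded by a quantity already
  determined by the cell of level \<open>j\<close>.\<close>

lemma sibling_max_mod: "j \<le> L \<Longrightarrow> sibling_max j (c mod M L) = sibling_max j c"
  by (simp add: sibling_max_def mod_mod_cancel M_dvd)

lemma pred_max_mod: "L' \<le> L \<Longrightarrow> pred_max L' (c mod M L) = pred_max L' c"
  by (auto simp: pred_max_def sibling_max_mod intro!: arg_cong[of _ _ Max] image_cong)

lemma sibling_max_le_pred_max: "j \<le> L \<Longrightarrow> sibling_max j c \<le> pred_max L c"
  unfolding pred_max_def by (intro Max_ge) auto

lemma pred_max_mono: "L' \<le> L \<Longrightarrow> pred_max L' c \<le> pred_max L c"
  unfolding pred_max_def by (intro Max_mono) auto

lemma phi_le_sibling_max: "norm (\<phi> (Suc j) c) \<le> sibling_max j c"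
proof -
  have "norm (\<phi> (Suc j) c) = norm (\<phi> (Suc j) (dg c j * M j + c mod M j))"
    using phi_mod[of "Suc j" c] by (simp add: mod_M_Suc)
  also have "\<dots> \<le> sibling_max j c" unfolding sibling_max_def by (intro Max_ge) auto
  finally show ?thesis .
qed

text \<open>Starting from 0 makes the difference of index 0 equal to \<open>\<phi> 1\<close>, mean
  included; this is why atoms on the whole group may have nonzero mean.\<close>

definition phi_from1 :: "nat \<Rightarrow> nat \<Rightarrow> complex" where
  "phi_from1 n c = (if n = 0 then 0 else \<phi> n c)"

lemma phi_from1_le_pred_max: "n \<le> Suc L \<Longrightarrow> norm (phi_from1 n c) \<le> pred_max L c"
proof (cases n)
  case 0
  have "0 \<le> norm (\<phi> (Suc 0) c)" by simp
  also have "\<dots> \<le> pred_max L c"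
    by (rule order_trans[OF phi_le_sibling_max sibling_max_le_pred_max]) simp
  finally show ?thesis using 0 by (simp add: phi_from1_def)
next
  case (Suc j)
  moreover assume "n \<le> Suc L"
  ultimately show ?thesis using order_trans[OF phi_le_sibling_max sibling_max_le_pred_max, of j L c] by (simp add: phi_from1_def)
qed

definition mart_diff :: "nat \<Rightarrow> nat \<Rightarrow> complex" where
  "mart_diff L c = phi_from1 (Suc L) c - phi_from1 L c"

lemma sum_mart_diff: "(\<Sum>L<n. mart_diff L c) = phi_from1 n c"
  using sum_lessThan_telescope[of "\<lambda>n. phi_from1 n c" n] by (simp add: mart_diff_def phi_from1_def[of 0])

lemma mart_diff_eq_0: "pred_max L c \<le> 0 \<Longrightarrow> mart_diff L c = 0"
  using order_trans[OF phi_from1_le_pred_max, of "Suc L" L c 0] order_trans[OF phi_from1_le_pred_max, of L L c 0]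
  by (simp add: mart_diff_def)

text \<open>As \<open>pred_max\<close> increases with the level, the summands kept form an initial
  segment and telescope to a value that \<open>pred_max\<close> still bounds by
  \<open>lam\<close>.\<close>

lemma norm_stopped_le:
  assumes "lam \<ge> 0"
  shows "norm (\<Sum>L<n. if pred_max L c \<le> lam then mart_diff L c else 0) \<le> lam"
proof (induction n)
  case (Suc n)
  show ?case
  proof (cases "pred_max n c \<le> lam")
    case True
    then have "pred_max L c \<le> lam" if "L < Suc n" for L using pred_max_mono[of L n c] that by simp
    then have "(\<Sum>L<Suc n. if pred_max L c \<le> lam then mart_diff L c else 0) = phi_from1 (Suc n) c"
      unfolding sum_mart_diff[symmetric] by (intro sum.cong) auto
    then show ?thesis using True phi_from1_le_pred_max[of "Suc n" n c] by simp
  qed (use Suc in simp)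
qed (use assms in simp)

section \<open>Dyadic layers and their atoms\<close>

definition scale :: "int \<Rightarrow> real" where
  "scale k = 2 powr of_int k"

lemma scale_pos [simp]: "scale k > 0" by (simp add: scale_def)

lemma scale_Suc: "scale (k + 1) = 2 * scale k" by (simp add: scale_def powr_add)

text \<open>The difference of the martingale stopped at two consecutive dyadic thresholds.\<close>

definition layer :: "int \<Rightarrow> nat \<Rightarrow> complex" where
  "layer k c = (\<Sum>L<N. if scale k < pred_max L c \<and> pred_max L c
      \<le> scale (k + 1) then mart_diff L c else 0)"

text \<open>The factor 3 adds the bounds \<open>2 * scale k\<close> and \<open>scale k\<close> for
  the two stopped martingales.\<close>

lemma norm_layer_le: "norm (layer k c) \<le> 3 * scale k"
proof -
  have "layer k c = (\<Sum>L<N. if pred_max L c \<le> scale (k + 1) then mart_diff L c else 0)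
      - (\<Sum>L<N. if pred_max L c \<le> scale k then mart_diff L c else 0)"
    unfolding layer_def sum_subtractf[symmetric] using scale_Suc[of k] scale_pos[of k]
    by (intro sum.cong refl) (auto simp del: scale_pos)
  also have "norm \<dots> \<le> scale (k + 1) + scale k"
    by (intro order_trans[OF norm_triangle_ineq4] add_mono norm_stopped_le less_imp_le scale_pos)
  finally show ?thesis by (simp add: scale_Suc)
qed

definition stops_at :: "real \<Rightarrow> nat \<Rightarrow> nat \<Rightarrow> bool" where
  "stops_at lam L c \<longleftrightarrow> lam < pred_max L c \<and> (\<forall>j<L. pred_max j c \<le> lam)"

lemma stops_at_mod: "stops_at lam L (c mod M L) = stops_at lam L c"
  by (simp add: stops_at_def pred_max_mod)

lemma sum_stops_at:
  fixes x :: "'b::comm_monoid_add"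
  shows "(\<Sum>L<N. if stops_at lam L c then x else 0) = (if \<exists>L<N. lam < pred_max L c then x else 0)"
proof (cases "\<exists>L<N. lam < pred_max L c")
  case True
  define L0 where "L0 = (LEAST L. lam < pred_max L c)"
  have L0: "lam < pred_max L0 c" "\<And>j. j < L0 \<Longrightarrow> \<not> lam < pred_max j c"
    unfolding L0_def using True LeastI_ex[of "\<lambda>L. lam < pred_max L c"] not_less_Least by blast+
  have "L0 < N" using True L0(2) by (meson le_less_trans not_less)
  moreover have "stops_at lam L c \<longleftrightarrow> L = L0" for L
    using L0 unfolding stops_at_def by (metis linorder_not_less nat_neq_iff)
  ultimately show ?thesis using True by simp
qed (auto simp: stops_at_def)

text \<open>A point stops at most once, at the least level where \<open>pred_max\<close> exceeds
  \<open>lam\<close>, and stopping is decided by the cell, so the stopping cells are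
  disjoint.\<close>

lemma sum_stops_at_cell:
  fixes x :: "'b::comm_monoid_add"
  shows "(\<Sum>L<N. \<Sum>u<M L. if stops_at lam L u \<and> c mod M L = u then x else 0)
      = (if \<exists>L<N. lam < pred_max L c then x else 0)"
proof -
  have "(\<Sum>u<M L. if stops_at lam L u \<and> c mod M L = u then x else 0)
      = (if stops_at lam L c then x else 0)" for L
  proof -
    have "(\<Sum>u<M L. if stops_at lam L u \<and> c mod M L = u then x else 0)
       = (\<Sum>u<M L. if u = c mod M L then (if stops_at lam L c then x else 0) else 0)"
      using stops_at_mod[of lam L c] by (intro sum.cong refl) auto
    then show ?thesis by simp
  qed
  then show ?thesis by (simp add: sum_stops_at)
qed

definition layer_atom :: "int \<Rightarrow> nat \<Rightarrow> nat \<Rightarrow> nat \<Rightarrow> complex" where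
  "layer_atom k L u c = (if stops_at (scale k) L u \<and> c mod M L = u then layer k c else 0)"

text \<open>Outside all stopping cells \<open>pred_max\<close> stays at most \<open>scale k\<close>,
  so no summand of the layer survives there.\<close>

lemma layer_eq_sum_atoms: "layer k c = (\<Sum>L<N. \<Sum>u<M L. layer_atom k L u c)"
proof -
  have "layer k c = 0" if "\<not> (\<exists>L<N. scale k < pred_max L c)"
    using that unfolding layer_def by (intro sum.neutral) auto
  then show ?thesis by (simp add: layer_atom_def sum_stops_at_cell)
qed

text \<open>On a cell of level \<open>L\<close> the factor \<open>\<xi>\<close> is constant and the
  differences average to 0 over the subcells. The case \<open>L = 0\<close> is excluded because
  \<open>mart_diff 0\<close> contains the mean.\<close>

lemma sum_predictable_mart_diff:
  assumes L: "L < N" "L \<noteq> 0" and \<xi>: "\<And>c. \<xi> (c mod M L) = \<xi> c"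
  shows "(\<Sum>c<M N. \<xi> c * mart_diff L c) = 0"
proof -
  define g where "g c = \<xi> c * mart_diff L c" for c
  define P where "P = M (Suc L)"
  have P: "P > 0" by (simp add: P_def)
  have \<xi>P: "\<xi> (c mod P) = \<xi> c" for c
    using \<xi>[of "c mod P"] \<xi>[of c] M_dvd[of L "Suc L"] by (simp add: P_def mod_mod_cancel)
  have \<phi>P: "\<phi> L (c mod P) = \<phi> L c" for c
    using phi_mod[of L "c mod P"] phi_mod[of L c] M_dvd[of L "Suc L"] by (simp add: P_def mod_mod_cancel)
  have gP: "g (c mod P) = g c" for c
    using L phi_mod[of "Suc L" c] by (simp add: g_def \<xi>P \<phi>P mart_diff_def phi_from1_def flip: P_def)
  have "(\<Sum>c<P. g c) = (\<Sum>v<m L. \<Sum>c<M L. g (v * M L + c))"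
    by (simp add: P_def M_Suc sum_lessThan_blocks)
  also have "\<dots> = (\<Sum>c<M L. \<Sum>v<m L. g (v * M L + c))" by (rule sum.swap)
  also have "\<dots> = 0"
  proof (rule sum.neutral, rule ballI)
    fix c assume "c \<in> {..<M L}"
    then have c: "c < M L" by simp
    have "g (v * M L + c) = \<xi> c * (\<phi> (Suc L) (v * M L + c) - \<phi> L c)" for v
      using c \<xi>[of "v * M L + c"] phi_mod[of L "v * M L
          + c"] L by (simp add: g_def mart_diff_def phi_from1_def)
    then have "(\<Sum>v<m L. g (v * M L + c))
        = \<xi> c * ((\<Sum>v<m L. \<phi> (Suc L) (v * M L + c)) - of_nat (m L) * \<phi> L c)"
      by (simp add: sum_distrib_left[symmetric] sum_subtractf)
    then show "(\<Sum>v<m L. g (v * M L + c)) = 0" using phi_avg[where n=L and c=c] c by simp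
  qed
  finally have 0: "(\<Sum>c<P. g c) = 0" .
  \<comment> \<open>The summand depends on \<open>c\<close> only modulo \<open>P\<close>, so the
    full sum consists of \<open>r\<close> copies of the vanishing one.\<close>
  obtain r where r: "M N = r * P"
    using M_dvd[of "Suc L" N] L by (metis P_def Suc_leI dvdE mult.commute)
  have "(\<Sum>c<M N. g c) = (\<Sum>v<r. \<Sum>c<P. g (v * P + c))" unfolding r by (rule sum_lessThan_blocks)
  also have "\<dots> = (\<Sum>v<r. \<Sum>c<P. g c)"
    by (intro sum.cong refl) (metis gP mod_mult_self3)
  finally show ?thesis using 0 by (simp add: g_def)
qed

lemma atom_layer_atom:
  assumes "L < N" "u < M L" "stops_at (scale k) L u"
  shows "atom N L u (3 * scale k) (layer_atom k L u)"
  unfolding atom_def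
proof (intro conjI allI impI)
  show "L \<le> N" "u < M L" "0 < 3 * scale k" using assms by auto
  show "norm (layer_atom k L u c) \<le> 3 * scale k" for c
    using norm_layer_le[of k c] scale_pos[of k] unfolding layer_atom_def by (simp del: scale_pos)
  show "c mod M L \<noteq> u \<Longrightarrow> layer_atom k L u c = 0" for c by (simp add: layer_atom_def)
  assume L: "L \<noteq> 0"
  \<comment> \<open>The indicator of the cell and the dyadic condition merge into one factor,
    predictable as soon as \<open>L'\<close> is at least \<open>L\<close>.\<close>
  define \<xi> where "\<xi> L' c
      = (if c mod M L = u \<and> scale k < pred_max L' c \<and> pred_max L' c
      \<le> scale (k + 1) then 1 else (0::complex))" for L' c
  have "layer_atom k L u c = (\<Sum>L'<N. \<xi> L' c * mart_diff L' c)" for c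
    using assms by (auto simp: layer_atom_def layer_def \<xi>_def intro!: sum.cong)
  then have "(\<Sum>c<M N. layer_atom k L u c) = (\<Sum>L'<N. \<Sum>c<M N. \<xi> L' c * mart_diff L' c)"
    by (simp only:) (rule sum.swap)
  also have "\<dots> = 0"
  proof (rule sum.neutral, rule ballI)
    fix L' assume "L' \<in> {..<N}"
    then have L': "L' < N" by simp
    show "(\<Sum>c<M N. \<xi> L' c * mart_diff L' c) = 0"
    proof (cases "L' < L")
      case True
      \<comment> \<open>Before the stopping level \<open>pred_max\<close> is at most
        \<open>scale k\<close> on the whole cell, so the layer has not started.\<close>
      have "\<xi> L' c = 0" for c
        using assms(3) True pred_max_mod[of L' L c] by (auto simp: \<xi>_def stops_at_def)
      then show ?thesis by simp
    next
      case False
      then show ?thesis using L L'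
        by (intro sum_predictable_mart_diff) (auto simp: \<xi>_def pred_max_mod mod_mod_cancel M_dvd)
    qed
  qed
  finally show "(\<Sum>c<M N. layer_atom k L u c) = 0" .
qed

definition scales :: "int set" where
  "scales = (\<lambda>(L, c). \<lceil>log 2 (pred_max L c)\<rceil> - 1) ` ({..<N} \<times> {..<M N})"

lemma finite_scales: "finite scales" by (simp add: scales_def)

text \<open>By \<open>dyadic_iff\<close> each difference with positive \<open>pred_max\<close> lies
  in exactly one layer; the other differences vanish.\<close>

lemma phi_eq_sum_layers:
  assumes "c < M N"
  shows "\<phi> N c = (\<Sum>k\<in>scales. layer k c)"
proof -
  have "(\<Sum>k\<in>scales. layer k c)
      = (\<Sum>L<N. \<Sum>k\<in>scales. if scale k < pred_max L c \<and> pred_max L c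
      \<le> scale (k + 1) then mart_diff L c else 0)"
    unfolding layer_def by (rule sum.swap)
  also have "\<dots> = (\<Sum>L<N. mart_diff L c)"
  proof (rule sum.cong[OF refl])
    fix L assume "L \<in> {..<N}"
    then have L: "L < N" by simp
    show "(\<Sum>k\<in>scales. if scale k < pred_max L c \<and> pred_max L c
        \<le> scale (k + 1) then mart_diff L c else 0) = mart_diff L c"
    proof (cases "pred_max L c > 0")
      case True
      have "(\<Sum>k\<in>scales. if scale k < pred_max L c \<and> pred_max L c
          \<le> scale (k + 1) then mart_diff L c else 0)
          = (\<Sum>k\<in>scales. if k = \<lceil>log 2 (pred_max L c)\<rceil> - 1 then mart_diff L c else 0)"
        unfolding scale_def dyadic_iff[OF True] ..
      also have "\<dots> = mart_diff L c"
        using L assms finite_scales by (subst sum.delta) (auto simp: scales_def)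
      finally show ?thesis .
    next
      case False
      then have "mart_diff L c = 0" by (intro mart_diff_eq_0) simp
      then show ?thesis by (simp cong: if_cong)
    qed
  qed
  also have "\<dots> = \<phi> N c" using N_pos by (simp add: sum_mart_diff phi_from1_def)
  finally show ?thesis ..
qed

section \<open>Stopping cells and the maximal function\<close>

definition max_fn :: "nat \<Rightarrow> real" where
  "max_fn c = Max ((\<lambda>n. norm (\<phi> n c)) ` {..N})"

lemma max_fn_ge: "n \<le> N \<Longrightarrow> norm (\<phi> n c) \<le> max_fn c"
  unfolding max_fn_def by (intro Max_ge) auto

lemma max_fn_nonneg: "max_fn c \<ge> 0"
  using max_fn_ge[of 0 c] norm_ge_zero[of "\<phi> 0 c"] by linarith

text \<open>Stopping at \<open>L\<close> is caused by a subcell of level \<open>Suc L\<close> on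
  which the martingale exceeds \<open>lam\<close>. It fills at least a \<open>1 / B\<close> part of
  the cell, and \<open>L < N\<close> puts its level within the range of
  \<open>max_fn\<close>.\<close>

lemma stopped_cell_le:
  assumes L: "L < N" "u < M L" and stops_at: "stops_at lam L u"
  shows "real (M N) / real (M L)
      \<le> real B * (\<Sum>c<M N. if c mod M L = u \<and> lam < max_fn c then 1 else 0)"
proof -
  obtain j where j: "j \<le> L" "lam < sibling_max j u"
  proof -
    have "pred_max L u \<in> (\<lambda>j. sibling_max j u) ` {..L}"
      unfolding pred_max_def by (intro Max_in) auto
    then show ?thesis using stops_at that by (auto simp: stops_at_def)
  qed
  \<comment> \<open>Only the newest level can have passed the threshold, all earlier maxima being at
    most \<open>lam\<close>.\<close>
  have "j = L"
  proof (rule ccontr)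
    assume "j \<noteq> L"
    then have "pred_max j u \<le> lam" using j stops_at by (simp add: stops_at_def)
    then show False using j sibling_max_le_pred_max[of j j u] by simp
  qed
  with j have "lam < sibling_max L u" by simp
  moreover have "sibling_max L u \<in> (\<lambda>v. norm (\<phi> (Suc L) (v * M L + u mod M L))) ` {..<m L}"
    unfolding sibling_max_def using m_pos[of L] by (intro Max_in) auto
  ultimately obtain v where v: "v < m L" "lam < norm (\<phi> (Suc L) (v * M L + u))" using L by auto
  define w where "w = v * M L + u"
  have "w < v * M L + M L" using L by (simp add: w_def)
  also have "\<dots> \<le> M (Suc L)" using v mult_le_mono1[of "Suc v" "m L" "M L"] by (simp add: M_Suc)
  finally have w: "w < M (Suc L)" .
  have "real (M N) / real (M L) = real (m L) * (real (M N) / real (M (Suc L)))"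
    using m_pos[of L] by (simp add: M_Suc field_simps)
  also have "\<dots> \<le> real B * (real (M N) / real (M (Suc L)))"
    using m_le[of L] by (intro mult_right_mono) auto
  also have "real (M N) / real (M (Suc L)) = real (card {c. c < M N \<and> c mod M (Suc L) = w})"
    using L w by (simp add: card_cell)
  also have "real B * \<dots> \<le> real B * real (card {c. c < M N \<and> (c mod M L = u \<and> lam < max_fn c)})"
  proof (rule mult_left_mono)
    show "real (card {c. c < M N \<and> c mod M (Suc L) = w})
        \<le> real (card {c. c < M N \<and> (c mod M L = u \<and> lam < max_fn c)})"
    proof (intro of_nat_mono card_mono subsetI)
      fix c assume "c \<in> {c. c < M N \<and> c mod M (Suc L) = w}"
      then have c: "c < M N" "c mod M (Suc L) = w" by auto
      have "c mod M L = w mod M L"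
        using c(2) M_dvd[of L "Suc L"] by (metis le_SucI mod_mod_cancel order_refl)
      then have "c mod M L = u" using L by (simp add: w_def)
      moreover have "\<phi> (Suc L) c = \<phi> (Suc L) w" using phi_mod[of "Suc L" c] c by simp
      then have "lam < max_fn c" using v max_fn_ge[of "Suc L" c] L by (simp add: w_def)
      ultimately show "c \<in> {c. c < M N \<and> (c mod M L = u \<and> lam < max_fn c)}" using c by simp
    qed simp
  qed simp
  also have "real (card {c. c < M N \<and> (c mod M L = u \<and> lam < max_fn c)})
     = (\<Sum>c<M N. if c mod M L = u \<and> lam < max_fn c then 1 else 0)"
    by (subst sum.inter_filter[symmetric]) auto
  finally show ?thesis .
qed

text \<open>The local estimates of \<open>stopped_cell_le\<close> add up because the stopping cells
  are disjoint.\<close>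

lemma sum_stopped_cells_le:
  "(\<Sum>L<N. \<Sum>u<M L. if stops_at lam L u then real (M N) / real (M L) else 0)
    \<le> real B * (\<Sum>c<M N. if lam < max_fn c then 1 else 0)"
proof -
  have "(\<Sum>L<N. \<Sum>u<M L. if stops_at lam L u then real (M N) / real (M L) else 0)
    \<le> (\<Sum>L<N. \<Sum>u<M L. \<Sum>c<M N. if stops_at lam L u \<and> c mod M L = u then (if lam < max_fn c then real B else 0) else 0)"
  proof (intro sum_mono)
    fix L u assume "L \<in> {..<N}" "u \<in> {..<M L}"
    then have *: "L < N" "u < M L" by auto
    show "(if stops_at lam L u then real (M N) / real (M L) else 0) \<le>
      (\<Sum>c<M N. if stops_at lam L u \<and> c mod M L = u then (if lam < max_fn c then real B else 0) else 0)"
    proof (cases "stops_at lam L u")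
      case True
      have "real B * (\<Sum>c<M N. if c mod M L = u \<and> lam < max_fn c then 1 else 0) =
        (\<Sum>c<M N. if stops_at lam L u \<and> c mod M L = u then (if lam < max_fn c then real B else 0) else 0)"
        unfolding sum_distrib_left using True by (intro sum.cong) auto
      then show ?thesis using stopped_cell_le[OF * True] True by simp
    qed simp
  qed
  also have "\<dots> = (\<Sum>L<N. \<Sum>c<M N. \<Sum>u<M L. if stops_at lam L u \<and> c mod M L = u
      then (if lam < max_fn c then real B else 0) else 0)"
    by (rule sum.cong[OF refl], rule sum.swap)
  also have "\<dots> = (\<Sum>c<M N. \<Sum>L<N. \<Sum>u<M L. if stops_at lam L u \<and> c mod M L = u
      then (if lam < max_fn c then real B else 0) else 0)"
    by (rule sum.swap)
  also have "\<dots> \<le> (\<Sum>c<M N. if lam < max_fn c then real B else 0)"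
    by (intro sum_mono) (simp add: sum_stops_at_cell)
  also have "\<dots> = real B * (\<Sum>c<M N. if lam < max_fn c then 1 else 0)"
    unfolding sum_distrib_left by (intro sum.cong) auto
  finally show ?thesis .
qed

text \<open>Sums over cells replace integrals, so this is \<open>M N\<close> times a partial sum of
  the series.\<close>

definition strong_sum :: "real \<Rightarrow> nat \<Rightarrow> (nat \<Rightarrow> complex) \<Rightarrow> real" where
  "strong_sum p n0 F = (\<Sum>n=1..n0. real n powr (2 * p - 2)
      * (\<Sum>x<M N. norm (norlund N F n x) powr p))"

lemma norlund_cong: "(\<And>c. c < M N \<Longrightarrow> F c = G c) \<Longrightarrow> norlund N F n x = norlund N G n x"
  by (simp add: norlund_def fourier_sum_eq_dirichlet)

lemma strong_sum_subadditive:
  assumes "finite I" "0 < p" "p \<le> 1" "\<And>c. c < M N \<Longrightarrow> F c = (\<Sum>i\<in>I. f i c)"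
  shows "strong_sum p n0 F \<le> (\<Sum>i\<in>I. strong_sum p n0 (f i))"
proof -
  have "strong_sum p n0 F
      \<le> (\<Sum>n=1..n0. real n powr (2 * p - 2) * (\<Sum>x<M N. \<Sum>i\<in>I. norm (norlund N (f i) n x) powr p))"
    unfolding strong_sum_def using assms norm_sum_powr_le[OF assms(1-3)]
    by (intro sum_mono mult_left_mono) (auto simp: norlund_cong[OF assms(4)] norlund_sum)
  also have "\<dots> = (\<Sum>n=1..n0. \<Sum>i\<in>I. real n powr (2 * p - 2)
      * (\<Sum>x<M N. norm (norlund N (f i) n x) powr p))"
    by (subst sum.swap[of _ I]) (simp add: sum_distrib_left)
  also have "\<dots> = (\<Sum>i\<in>I. strong_sum p n0 (f i))" unfolding strong_sum_def by (rule sum.swap)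
  finally show ?thesis .
qed

text \<open>Subadditivity reduces the claim to atoms. Their bounds add up over the stopping cells to
  the size of the set where \<open>max_fn\<close> exceeds \<open>scale k\<close>, and then over the
  scales by \<open>sum_dyadic_le\<close>.\<close>

lemma strong_sum_phi_le:
  assumes p: "0 < p" "p < 1/2" and n0: "n0 \<le> M N"
  shows "strong_sum p n0 (\<phi> N) \<le> C_strong p * (\<Sum>c<M N. max_fn c powr p)"
proof -
  have C: "C_atom_sum p \<ge> 0" by (rule C_atom_sum_nonneg[OF p(2)])
  have "strong_sum p n0 (\<phi> N) \<le> (\<Sum>k\<in>scales. strong_sum p n0 (layer k))"
    using p by (intro strong_sum_subadditive finite_scales phi_eq_sum_layers) auto
  also have "\<dots> \<le> (\<Sum>k\<in>scales. \<Sum>L<N. strong_sum p n0 (\<lambda>c. \<Sum>u<M L. layer_atom k L u c))"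
    using p by (intro sum_mono strong_sum_subadditive layer_eq_sum_atoms) auto
  also have "\<dots> \<le> (\<Sum>k\<in>scales. \<Sum>L<N. \<Sum>u<M L. strong_sum p n0 (layer_atom k L u))"
    using p by (intro sum_mono strong_sum_subadditive) auto
  also have "\<dots> \<le> (\<Sum>k\<in>scales. \<Sum>L<N. \<Sum>u<M L. C_atom_sum p * 3 powr p * scale k powr p
      * (if stops_at (scale k) L u then real (M N) / real (M L) else 0))"
  proof (intro sum_mono)
    fix k L u assume "L \<in> {..<N}" "u \<in> {..<M L}"
    then have *: "L < N" "u < M L" by auto
    show "strong_sum p n0 (layer_atom k L u)
        \<le> C_atom_sum p * 3 powr p * scale k powr p
        * (if stops_at (scale k) L u then real (M N) / real (M L) else 0)"
    proof (cases "stops_at (scale k) L u")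
      case True
      show ?thesis
        using atom_sum_norlund_Lp[OF atom_layer_atom[OF * True] n0 p] True scale_pos[of k]
        by (simp add: strong_sum_def powr_mult mult_ac)
    next
      case False
      then have "norlund N (layer_atom k L u) n x = 0" for n x
        by (simp add: norlund_def fourier_sum_eq_dirichlet layer_atom_def)
      then show ?thesis using False p by (simp add: strong_sum_def)
    qed
  qed
  also have "\<dots> = (\<Sum>k\<in>scales. C_atom_sum p * 3 powr p * scale k powr p
      * (\<Sum>L<N. \<Sum>u<M L. if stops_at (scale k) L u then real (M N) / real (M L) else 0))"
    by (simp only: sum_distrib_left)
  also have "\<dots> \<le> (\<Sum>k\<in>scales. C_atom_sum p * 3 powr p * scale k powr p
      * (real B * (\<Sum>c<M N. if scale k < max_fn c then 1 else 0)))"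
    using C by (intro sum_mono mult_left_mono sum_stopped_cells_le) auto
  also have "\<dots> = (\<Sum>k\<in>scales. \<Sum>c<M N. C_atom_sum p * 3 powr p * real B
      * (if scale k < max_fn c then scale k powr p else 0))"
    unfolding sum_distrib_left by (intro sum.cong refl) auto
  also have "\<dots> = C_atom_sum p * 3 powr p * real B
      * (\<Sum>c<M N. \<Sum>k\<in>scales. if scale k < max_fn c then scale k powr p else 0)"
    by (subst sum.swap) (simp add: sum_distrib_left)
  also have "\<dots> \<le> C_atom_sum p * 3 powr p * real B * (\<Sum>c<M N. max_fn c powr p / (1 - 2 powr (- p)))"
    unfolding scale_def using C p by (intro mult_left_mono sum_mono sum_dyadic_le finite_scales max_fn_nonneg) auto
  also have "\<dots> = C_strong p * (\<Sum>c<M N. max_fn c powr p)"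
    by (simp add: C_strong_def sum_divide_distrib[symmetric])
  finally show ?thesis .
qed

end

section \<open>Integration of cylinder functions\<close>

context vilenkin_group
begin

abbreviation "\<mu> \<equiv> vil_mu m"

lemma space_mu: "x \<in> space \<mu> \<longleftrightarrow> (\<forall>j. x j < m j)"
  by (auto simp: vil_mu_def space_PiM space_uniform_count_measure PiE_def Pi_def extensional_def)

lemma dg_in_space [simp]: "dg c \<in> space \<mu>"
  by (simp add: space_mu)

text \<open>Numbers the cells of level \<open>N\<close>; conversely \<open>dg c\<close> serves as
  the representative point of the cell numbered \<open>c\<close>.\<close>

definition cell_index :: "nat \<Rightarrow> (nat \<Rightarrow> nat) \<Rightarrow> nat" where
  "cell_index N x = (\<Sum>j<N. x j * M j)"

lemma cell_index_less: "x \<in> space \<mu> \<Longrightarrow> cell_index N x < M N"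
proof (induction N)
  case (Suc N)
  have "x N * M N + cell_index N x < (x N + 1) * M N" using Suc by simp
  also have "\<dots> \<le> m N * M N"
    using Suc.prems by (intro mult_right_mono) (auto simp: space_mu Suc_le_eq)
  finally show ?case by (simp add: cell_index_def M_Suc add.commute)
qed (simp add: cell_index_def)

lemma dg_cell_index: "x \<in> space \<mu> \<Longrightarrow> j < N \<Longrightarrow> dg (cell_index N x) j = x j"
proof (induction N)
  case (Suc N)
  have "cell_index (Suc N) x = x N * M N + cell_index N x" by (simp add: cell_index_def)
  then have "dg (cell_index (Suc N) x) j = dg (x N * M N) j + dg (cell_index N x) j"
    using dg_add_block[OF cell_index_less[OF Suc.prems(1), of N]] by simp
  also have "\<dots> = x j"
    using Suc dg_mult_M[of "x N" N j] dg_eq_0[OF cell_index_less[OF Suc.prems(1), of N]]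
    by (cases "j = N") (auto simp: space_mu)
  finally show ?case .
qed simp

lemma cell_index_eq_iff:
  assumes "x \<in> space \<mu>" "c < M N"
  shows "cell_index N x = c \<longleftrightarrow> (\<forall>j<N. x j = dg c j)"
proof -
  have "cell_index N x = c \<longleftrightarrow> cell_index N x mod M N = c mod M N"
    using assms cell_index_less by simp
  then show ?thesis unfolding mod_eq_iff_dg using assms by (auto simp: dg_cell_index)
qed

lemma cell_index_dg: "cell_index N (dg c) = c mod M N"
  by (subst cell_index_eq_iff) (auto simp: dg_mod)

lemma vil_I_dg: "vil_I m N (dg c) = {x \<in> space \<mu>. cell_index N x = c mod M N}"
  unfolding vil_I_def using cell_index_eq_iff[of _ "c mod M N" N] by (auto simp: dg_mod)

lemma cell_measure:
  "vil_I m N (dg c) \<in> sets \<mu>" "emeasure \<mu> (vil_I m N (dg c)) = ennreal (1 / real (M N))"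
proof -
  interpret product_prob_space "\<lambda>j. uniform_count_measure {..<m j}" UNIV
    by (intro product_prob_spaceI prob_space_uniform_count_measure)
       (use m_pos in \<open>auto simp: lessThan_empty_iff\<close>)
  have I: "vil_I m N (dg c) = {x \<in> space \<mu>. \<forall>j\<in>{..<N}. x j \<in> {dg c j}}"
    by (auto simp: vil_I_def)
  show "vil_I m N (dg c) \<in> sets \<mu>"
    unfolding I vil_mu_def
    by (intro sets_PiM_I_finite sets.sets_Collect_finite_All measurable_sets)
       (auto intro!: sets_Collect_single)
  have "emeasure \<mu> (vil_I m N (dg c)) = (\<Prod>j<N. emeasure (uniform_count_measure {..<m j}) {dg c j})"
    unfolding I vil_mu_def
    by (subst emeasure_PiM_Collect) (auto simp: sets_uniform_count_measure)
  also have "\<dots> = (\<Prod>j<N. ennreal (1 / real (m j)))"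
    by (intro prod.cong refl) (simp add: emeasure_uniform_count_measure)
  also have "\<dots> = ennreal (\<Prod>j<N. 1 / real (m j))" by (rule prod_ennreal) simp
  also have "(\<Prod>j<N. 1 / real (m j)) = 1 / real (M N)"
    by (simp add: vil_M_def prod_dividef)
  finally show "emeasure \<mu> (vil_I m N (dg c)) = ennreal (1 / real (M N))" .
qed

lemma nn_integral_cell_index:
  "(\<integral>\<^sup>+x. v (cell_index N x) \<partial>\<mu>) = (\<Sum>c<M N. v c) * ennreal (1 / real (M N))"
proof -
  have "(\<integral>\<^sup>+x. v (cell_index N x) \<partial>\<mu>) = (\<integral>\<^sup>+x. (\<Sum>c<M N. v c * indicator (vil_I m N (dg c)) x) \<partial>\<mu>)"
  proof (rule nn_integral_cong)
    fix x assume x: "x \<in> space \<mu>"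
    have "(\<Sum>c<M N. v c * indicator (vil_I m N (dg c)) x)
        = (\<Sum>c<M N. if c = cell_index N x then v c else 0)"
      using x by (intro sum.cong refl) (auto simp: vil_I_dg)
    then show "v (cell_index N x) = (\<Sum>c<M N. v c * indicator (vil_I m N (dg c)) x)"
      using cell_index_less[OF x] by simp
  qed
  also have "\<dots> = (\<Sum>c<M N. v c * ennreal (1 / real (M N)))"
    using cell_measure by (subst nn_integral_sum) (auto simp: nn_integral_cmult_indicator)
  finally show ?thesis by (simp add: sum_distrib_right)
qed

lemma integral_cell_index:
  fixes v :: "nat \<Rightarrow> complex"
  shows "(LINT x|\<mu>. v (cell_index N x)) = (\<Sum>c<M N. v c) / of_nat (M N)"
proof -
  have "(LINT x|\<mu>. v (cell_index N x))
      = (LINT x|\<mu>. (\<Sum>c<M N. indicator (vil_I m N (dg c)) x *\<^sub>R v c))"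
  proof (rule Bochner_Integration.integral_cong[OF refl])
    fix x assume x: "x \<in> space \<mu>"
    have "(\<Sum>c<M N. indicator (vil_I m N (dg c)) x *\<^sub>R v c)
        = (\<Sum>c<M N. if c = cell_index N x then v c else 0)"
      using x by (intro sum.cong refl) (auto simp: vil_I_dg)
    then show "v (cell_index N x) = (\<Sum>c<M N. indicator (vil_I m N (dg c)) x *\<^sub>R v c)"
      using cell_index_less[OF x] by simp
  qed
  also have "\<dots> = (\<Sum>c<M N. measure \<mu> (vil_I m N (dg c)) *\<^sub>R v c)"
    by (intro has_bochner_integral_integral_eq has_bochner_integral_sum has_bochner_integral_indicator)
       (auto simp: cell_measure)
  also have "\<dots> = (\<Sum>c<M N. v c) / of_nat (M N)"
    by (simp add: measure_def cell_measure sum_divide_distrib scaleR_conv_of_real)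
  finally show ?thesis .
qed

lemma chi_Suc: "i < M k \<Longrightarrow> chi (Suc k) i c = chi k i c"
  by (simp add: chi_def dg_eq_0)

lemma vilenkin_eq_chi:
  assumes x: "x \<in> space \<mu>" and i: "i < M N"
  shows "vilenkin m i x = chi N i (cell_index N x)"
proof -
  define g where "g k = rademacher m k x ^ dg i k" for k
  have g1: "g k = 1" if "dg i k = 0" for k by (simp add: g_def that)
  have "i < M i" by (rule less_M)
  \<comment> \<open>One product runs up to \<open>i\<close>, the other up to \<open>N\<close>;
    beyond either bound the digits of \<open>i\<close> are 0, so both equal the product up to
    \<open>i + N\<close>.\<close>
  then have "vilenkin m i x = (\<Prod>k<i + N. g k)"
    unfolding vilenkin_def g_def[symmetric]
    by (intro prod.mono_neutral_left) (auto intro!: g1 dg_eq_0[of i i])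
  also have "\<dots> = (\<Prod>k<N. g k)"
    by (intro prod.mono_neutral_right) (auto intro!: g1 dg_eq_0[OF i])
  also have "\<dots> = chi N i (cell_index N x)"
    unfolding chi_def
  proof (rule prod.cong[OF refl])
    fix k assume "k \<in> {..<N}"
    then have "dg (cell_index N x) k = x k" using dg_cell_index x by simp
    moreover have "rademacher m k x = cis (2 * pi * real (x k) / real (m k))"
      by (simp add: rademacher_def cis_conv_exp mult_ac)
    ultimately show "g k = cis (2 * pi * real (dg i k) * real (dg (cell_index N x) k) / real (m k))"
      unfolding g_def Complex.DeMoivre[symmetric] by (simp add: Complex.DeMoivre mult_ac)
  qed
  finally show ?thesis .
qed

section \<open>Transfer of martingales and Fourier coefficients to cells\<close>

lemma martingale_eq_cell_index:
  assumes "vil_martingale m f" "x \<in> space \<mu>" "n \<le> N"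
  shows "f n x = f n (dg (cell_index N x))"
proof -
  have "x \<in> vil_I m n (dg (cell_index N x))" using assms by (auto simp: vil_I_def dg_cell_index)
  then show ?thesis using assms(1) unfolding vil_martingale_def by (metis dg_in_space)
qed

lemma martingale_mod:
  assumes "vil_martingale m f"
  shows "f n (dg (c mod M n)) = f n (dg c)"
  using martingale_eq_cell_index[OF assms dg_in_space[of c], of n n] by (simp add: cell_index_dg)

text \<open>Both integrals over a cell of level \<open>n\<close> are evaluated on its
  \<open>m n\<close> subcells, at the common level \<open>Suc n\<close>.\<close>

lemma martingale_avg:
  assumes f: "vil_martingale m f"
  shows "(\<Sum>v<m n. f (Suc n) (dg (v * M n + c mod M n))) = of_nat (m n) * f n (dg c)"
proof -
  define u where "u = c mod M n"
  have u: "u < M n" by (simp add: u_def)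
  have I: "(LINT y:vil_I m n (dg u)|\<mu>. f k y)
      = (\<Sum>v<m n. f k (dg (v * M n + u))) / of_nat (M (Suc n))"
    if k: "k \<le> Suc n" for k
  proof -
    have "(LINT y:vil_I m n (dg u)|\<mu>. f k y) =
       (LINT y|\<mu>. (\<lambda>c. if c mod M n = u then f k (dg c) else 0) (cell_index (Suc n) y))"
      unfolding set_lebesgue_integral_def
    proof (rule Bochner_Integration.integral_cong[OF refl])
      fix y assume y: "y \<in> space \<mu>"
      have "cell_index (Suc n) y mod M n = cell_index n y"
        using cell_index_less[OF y, of n] by (simp add: cell_index_def)
      then show "indicator (vil_I m n (dg u)) y *\<^sub>R f k y =
          (\<lambda>c. if c mod M n = u then f k (dg c) else 0) (cell_index (Suc n) y)"
        using martingale_eq_cell_index[OF f y k] y u by (auto simp: vil_I_dg)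
    qed
    also have "\<dots> = (\<Sum>c<m n * M n. if c mod M n = u then f k (dg c) else 0) / of_nat (M (Suc n))"
      using integral_cell_index[of "\<lambda>c. if c mod M n
          = u then f k (dg c) else 0" "Suc n"] by (simp add: M_Suc)
    also have "(\<Sum>c<m n * M n. if c mod M n = u then f k (dg c) else 0)
        = (\<Sum>c | c < m n * M n \<and> c mod M n = u. f k (dg c))"
      by (subst sum.inter_filter[symmetric]) auto
    also have "\<dots> = (\<Sum>v<m n. f k (dg (v * M n + u)))" by (rule sum_cell[OF u])
    finally show ?thesis .
  qed
  have "f n (dg (v * M n + u)) = f n (dg c)" for v
    using martingale_mod[OF f, of n "v * M n + u"] martingale_mod[OF f, of n c] by (simp add: u_def)
  then have "(\<Sum>v<m n. f n (dg (v * M n + u))) = of_nat (m n) * f n (dg c)" by simp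
  moreover have "(LINT y:vil_I m n (dg u)|\<mu>. f (Suc n) y) = (LINT y:vil_I m n (dg u)|\<mu>. f n y)"
    using f dg_in_space unfolding vil_martingale_def by blast
  ultimately have "(\<Sum>v<m n. f (Suc n) (dg (v * M n + u))) / of_nat (M (Suc n))
      = of_nat (m n) * f n (dg c) / of_nat (M (Suc n))"
    using I[of "Suc n"] I[of n] by simp
  then show ?thesis unfolding u_def by (simp del: of_nat_mult)
qed

text \<open>A character of index below \<open>M k\<close> ignores digit \<open>k\<close>, so the
  inner sum over subcells is the one computed by \<open>martingale_avg\<close>.\<close>

lemma coeff_Suc:
  assumes f: "vil_martingale m f" and i: "i < M k"
  shows "coeff (Suc k) (\<lambda>c. f (Suc k) (dg c)) i = coeff k (\<lambda>c. f k (dg c)) i"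
proof -
  have chi_block: "chi (Suc k) i (v * M k + c) = chi k i c" if "c < M k" for v c
    using chi_mod[OF i order_refl, of "v * M k + c" c] chi_Suc[OF i] that by simp
  have "(\<Sum>c<M (Suc k). f (Suc k) (dg c) * cnj (chi (Suc k) i c))
      = (\<Sum>v<m k. \<Sum>c<M k. f (Suc k) (dg (v * M k + c)) * cnj (chi k i c))"
    unfolding M_Suc sum_lessThan_blocks by (intro sum.cong refl) (simp add: chi_block)
  also have "\<dots> = (\<Sum>c<M k. of_nat (m k) * f k (dg c) * cnj (chi k i c))"
  proof (subst sum.swap, rule sum.cong[OF refl])
    fix c assume "c \<in> {..<M k}"
    then show "(\<Sum>v<m k. f (Suc k) (dg (v * M k + c)) * cnj (chi k i c))
        = of_nat (m k) * f k (dg c) * cnj (chi k i c)"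
      using martingale_avg[OF f, of k c] by (simp add: sum_distrib_right[symmetric])
  qed
  also have "\<dots> = of_nat (m k) * (\<Sum>c<M k. f k (dg c) * cnj (chi k i c))"
    by (simp add: sum_distrib_left mult_ac)
  finally show ?thesis using m_pos[of k] by (simp add: coeff_def M_Suc)
qed

text \<open>The integrals whose limit defines the coefficient are constant from level
  \<open>N\<close> on.\<close>

lemma fourier_coeff_eq:
  assumes f: "vil_martingale m f" and i: "i < M N"
  shows "fourier_coeff m f i = coeff N (\<lambda>c. f N (dg c)) i"
proof -
  have i': "i < M k" if "N \<le> k" for k using i M_mono[OF that] by simp
  have "coeff k (\<lambda>c. f k (dg c)) i = coeff N (\<lambda>c. f N (dg c)) i" if "N \<le> k" for k
    using that by (induction k rule: dec_induct) (auto simp: coeff_Suc[OF f i'])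
  moreover have "(LINT x|\<mu>. f k x * cnj (vilenkin m i x)) = coeff k (\<lambda>c. f k (dg c)) i"
    if "N \<le> k" for k
  proof -
    have "(LINT x|\<mu>. f k x * cnj (vilenkin m i x))
        = (LINT x|\<mu>. (\<lambda>c. f k (dg c) * cnj (chi k i c)) (cell_index k x))"
    proof (rule Bochner_Integration.integral_cong[OF refl])
      fix x assume x: "x \<in> space \<mu>"
      show "f k x * cnj (vilenkin m i x) = (\<lambda>c. f k (dg c) * cnj (chi k i c)) (cell_index k x)"
        unfolding vilenkin_eq_chi[OF x i'[OF that]]
        by (subst martingale_eq_cell_index[OF f x order_refl]) (rule refl)
    qed
    then show ?thesis
      using integral_cell_index[of "\<lambda>c. f k (dg c) * cnj (chi k i c)" k] by (simp add: coeff_def)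
  qed
  ultimately have "(LINT x|\<mu>. f k x * cnj (vilenkin m i x)) = coeff N (\<lambda>c. f N (dg c)) i"
    if "N \<le> k" for k
    using that by metis
  then have "(\<lambda>k. LINT x|\<mu>. f k x * cnj (vilenkin m i x)) \<longlonglongrightarrow> coeff N (\<lambda>c. f N (dg c)) i"
    by (intro tendsto_eventually eventually_sequentiallyI[of N])
  then show ?thesis unfolding fourier_coeff_def by (rule limI)
qed

lemma partial_sum_eq:
  assumes f: "vil_martingale m f" and x: "x \<in> space \<mu>" and j: "j \<le> M N"
  shows "partial_sum m f j x = fourier_sum N (\<lambda>c. f N (dg c)) j (cell_index N x)"
  unfolding partial_sum_def fourier_sum_def using j
  by (intro sum.cong refl) (simp add: fourier_coeff_eq[OF f, of _ N] vilenkin_eq_chi[OF x])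

end

section \<open>The strong summability estimate\<close>

context vilenkin_norlund
begin

lemma norlund_mean_eq:
  assumes "vil_martingale m f" "x \<in> space \<mu>" "n \<le> M N"
  shows "norlund_mean m q f n x = norlund N (\<lambda>c. f N (dg c)) n (cell_index N x)"
  unfolding norlund_mean_def norlund_def using assms
  by (intro arg_cong2[of _ _ _ _ "(*)"] refl sum.cong) (auto simp: partial_sum_eq)

lemma strong_summability:
  assumes p: "0 < p" "p < 1/2" and f: "vil_martingale m f"
  shows "(\<Sum>k. Lp_norm_pow m p (norlund_mean m q f (Suc k)) / ennreal (real (Suc k) powr (2 - 2
      * p)))
         \<le> ennreal (C_strong p) * Hp_norm_pow m p f"
  unfolding suminf_eq_SUP
proof (rule SUP_least)
  fix K0
  \<comment> \<open>This level is positive and, since \<open>K0 \<le> M N\<close>, carries all means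
    up to index \<open>K0\<close>.\<close>
  define N where "N = Suc K0"
  have K0: "K0 \<le> M N" using less_M[of N] by (simp add: N_def)
  interpret vilenkin_martingale m B q "\<lambda>n c. f n (dg c)" N
    by unfold_locales (auto simp: martingale_mod[OF f] martingale_avg[OF f] N_def)
  let ?F = "\<lambda>c. f N (dg c)"
  have C: "C_strong p \<ge> 0"
    using C_atom_sum_nonneg[OF p(2)] p by (simp add: C_strong_def powr_less_one less_imp_le)
  have L: "Lp_norm_pow m p (norlund_mean m q f (Suc k)) / ennreal (real (Suc k) powr (2 - 2 * p))
      = ennreal (real (Suc k) powr (2 * p - 2) * (\<Sum>c<M N. norm (norlund N ?F (Suc k) c) powr p) / real (M N))"
    if "k < K0" for k
  proof -
    have "Lp_norm_pow m p (norlund_mean m q f (Suc k))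
        = (\<integral>\<^sup>+x. (\<lambda>c. ennreal (norm (norlund N ?F (Suc k) c) powr p)) (cell_index N x) \<partial>\<mu>)"
      unfolding Lp_norm_pow_def using that K0
      by (intro nn_integral_cong) (simp add: norlund_mean_eq[OF f, of _ _ N])
    also have "\<dots> = ennreal ((\<Sum>c<M N. norm (norlund N ?F (Suc k) c) powr p) / real (M N))"
      using nn_integral_cell_index[of "\<lambda>c. ennreal (norm (norlund N ?F (Suc k) c) powr p)" N]
      by (simp add: sum_ennreal ennreal_mult'[symmetric] sum_nonneg)
    finally show ?thesis
      by (simp add: divide_ennreal sum_nonneg powr_diff powr_minus field_simps)
  qed
  have "(\<Sum>k<K0. Lp_norm_pow m p (norlund_mean m q f (Suc k)) / ennreal (real (Suc k) powr (2 - 2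
      * p)))
     = ennreal (\<Sum>k<K0. real (Suc k) powr (2 * p - 2) * (\<Sum>c<M N. norm (norlund N ?F (Suc k) c) powr p) / real (M N))"
    by (subst sum_ennreal[symmetric]) (auto simp: L sum_nonneg simp del: of_nat_Suc)
  also have "\<dots> = ennreal (strong_sum p K0 ?F / real (M N))"
    by (simp add: strong_sum_def sum.atLeast1_atMost_eq sum_divide_distrib)
  also have "\<dots> \<le> ennreal (C_strong p * (\<Sum>c<M N. max_fn c powr p) / real (M N))"
    by (intro ennreal_leI divide_right_mono strong_sum_phi_le p K0) auto
  also have "\<dots> = ennreal (C_strong p) * (\<integral>\<^sup>+x. (\<lambda>c. ennreal (max_fn c powr p)) (cell_index N x) \<partial>\<mu>)"
    using nn_integral_cell_index[of "\<lambda>c. ennreal (max_fn c powr p)" N] C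
    by (simp add: sum_ennreal ennreal_mult'[symmetric] sum_nonneg)
  also have "\<dots> \<le> ennreal (C_strong p) * Hp_norm_pow m p f"
    unfolding Hp_norm_pow_def
  proof (intro mult_left_mono nn_integral_mono)
    fix x assume x: "x \<in> space \<mu>"
    have "max_fn (cell_index N x) \<in> (\<lambda>n. norm (f n (dg (cell_index N x)))) ` {..N}"
      unfolding max_fn_def by (intro Max_in) auto
    then obtain n where n: "n \<le> N" "max_fn (cell_index N x) = norm (f n x)"
      using martingale_eq_cell_index[OF f x] by auto
    \<comment> \<open>The maximum over levels up to \<open>N\<close> lies below the supremum over
      all levels, which makes the bound independent of \<open>K0\<close>.\<close>
    show "ennreal (max_fn (cell_index N x) powr p) \<le> (SUP n. ennreal (cmod (f n x) powr p))"
      unfolding n(2) by (rule SUP_upper) simp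
  qed simp
  finally show "(\<Sum>k<K0. Lp_norm_pow m p (norlund_mean m q f (Suc k)) / ennreal (real (Suc k) powr (2 - 2 * p)))
    \<le> ennreal (C_strong p) * Hp_norm_pow m p f" .
qed

end

theorem theorem1:
  fixes m :: "nat \<Rightarrow> nat" and p :: real
  assumes m_ge2: "\<And>k. m k \<ge> 2"
    and m_bdd: "bdd_above (range m)"
    and p: "0 < p" "p < 1/2"
  shows "\<exists>c::real. c > 0 \<and>
    (\<forall>(q::nat \<Rightarrow> real) f.
       mono q \<longrightarrow> (\<forall>k. 0 \<le> q k) \<longrightarrow> q 0 > 0 \<longrightarrow>
       filterlim (norlund_Q q) at_top sequentially \<longrightarrow>
       (\<lambda>n. q (n - 1) / norlund_Q q n) \<longlonglongrightarrow> 0 \<longrightarrow>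
       in_Hp m p f \<longrightarrow>
       (\<Sum>k. Lp_norm_pow m p (norlund_mean m q f (Suc k))
               / ennreal (real (Suc k) powr (2 - 2 * p)))
         \<le> ennreal c * Hp_norm_pow m p f)"
proof -
  obtain B where B: "\<And>k. m k \<le> B" using m_bdd by (auto simp: bdd_above_def)
  interpret vilenkin_group m B by unfold_locales (use m_ge2 B in auto)
  show ?thesis
  \<comment> \<open>The constant depends on \<open>p\<close> and \<open>B\<close> only and is fixed
    before \<open>q\<close> and \<open>f\<close>; the maximum with 1 makes it positive.\<close>
  proof (intro exI[of _ "max 1 (C_strong p)"] conjI allI impI)
    fix q :: "nat \<Rightarrow> real" and f
    assume "mono q" "\<forall>k. 0 \<le> q k" "q 0 > 0" and f: "in_Hp m p f"
    then interpret vilenkin_norlund m B q by unfold_locales auto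
    have "(\<Sum>k. Lp_norm_pow m p (norlund_mean m q f (Suc k)) / ennreal (real (Suc k) powr (2 - 2
        * p)))
      \<le> ennreal (C_strong p) * Hp_norm_pow m p f"
      using f by (intro strong_summability p) (simp add: in_Hp_def)
    also have "\<dots> \<le> ennreal (max 1 (C_strong p)) * Hp_norm_pow m p f"
      by (intro mult_right_mono ennreal_leI) auto
    finally show "(\<Sum>k. Lp_norm_pow m p (norlund_mean m q f (Suc k)) / ennreal (real (Suc k) powr (2 - 2 * p)))
      \<le> ennreal (max 1 (C_strong p)) * Hp_norm_pow m p f" .
  qed simp
qed

end
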